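(* Let $\mathcal{L}\subset\operatorname{Lip}_1(\mathbb{R})$ be a monoidal subfamily that is self-compact. Let $X$ be an $\mathcal{L}$-closed geometric data set. The following are equivalent. (1) $X$ is $\mathcal{L}$-compact. (2) $\overline{F_X}/\mathcal{L}:=\{\mathcal{L}\circ f: f\in\overline{F_X}\}$ is totally bounded with respect to the Hausdorff distance $(d_{\mathrm{KF}}^X)_{\mathrm{H}}$. (3) $\mathcal{L}\circ\mathcal{F}(\overline{F_X}):=\{\mathcal{L}\circ F: F\in\mathcal{F}(\overline{F_X})\}$ is compact with respect to $(d_{\mathrm{KF}}^X)_{\mathrm{H}}$.
   Context: A geometric data set is a triple $X=(X,F_X,\mu_X)$ where $F_X$ is a nonempty set of real-valued functions on $X$ such that $d_X(x,y):=\sup_{f\in F_X}|f(x)-f(y)|$ is a complete separable metric on $X$, and $\mu_X$ is a Borel probability measure with full support on $(X,d_X)$. $\overline{F_X}$ is the closure of $F_X$ under pointwise convergence. Ky Fan metric: for a measure $\mu$, $d_{\mathrm{KF}}^\mu(f,g):=\inf\{\epsilon\ge 0: \mu(\{|f-g|>\epsilon\})\le\epsilon\}$; $d_{\mathrm{KF}}^X:=d_{\mathrm{KF}}^{\mu_X}$. $d_{\mathrm{H}}$ is the Hausdorff distance (between nonempty subsets) induced by $d$; $U(A,\epsilon;d)$ is the open $\epsilon$-neighborhood. $\mathcal{F}(\overline{F_X})$ is the set of nonempty closed subsets of $(\overline{F_X},d_{\mathrm{KF}}^X)$. $\operatorname{Lip}_1(\mathbb{R})$ is the set of 1-Lipschitz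 functions $\mathbb{R}\to\mathbb{R}$. $\mathcal{L}\subset\operatorname{Lip}_1(\mathbb{R})$ is monoidal if it contains $\mathrm{id}_{\mathbb{R}}$, is closed under composition, and is closed under pointwise convergence on $\mathbb{R}$. $\mathcal{L}\circ f:=\{p\circ f:p\in\mathcal{L}\}$ and $\mathcal{L}\circ F:=\{p\circ f: p\in\mathcal{L}, f\in F\}$. $X$ is $\mathcal{L}$-closed if $\mathcal{L}\circ\overline{F_X}\subset\overline{F_X}$. It is $\mathcal{L}$-compact if it is $\mathcal{L}$-closed and $\operatorname{Cov}(\overline{F_X},\epsilon;\mathcal{L})<\infty$ for every $\epsilon>0$, where $\operatorname{Cov}(F,\epsilon;\mathcal{L}):=\inf\{\#\mathcal{N}: \mathcal{N}\subset F\text{ finite}, F\subset U(\mathcal{L}\circ\mathcal{N},\epsilon;d_{\mathrm{KF}}^X)\}$. Self-compact: with $\gamma$ the standard Gaussian measure on $\mathbb{R}$, $\mathcal{L}$ is self-compact if $\mathcal{L}/\mathcal{L}:=\{\mathcal{L}\circ p: p\in\mathcal{L}\}$, viewed as a subset of the space of nonempty closed subsets of $(\operatorname{Lip}_1(\mathbb{R}),d_{\mathrm{KF}}^\gamma)$ with the Hausdorff distance $(d_{\mathrm{KF}}^\gamma)_{\mathrm{H}}$, is compact. *)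

theory Defs
  imports "HOL-Probability.Probability" "HOL-Library.Extended_Nat"
begin

section \<open>Pseudometric topology\<close>

text \<open>The Hausdorff distance on arbitrary nonempty (not necessarily closed) subsets is only a
  pseudometric, so the locale \<^locale>\<open>Metric_space\<close> does not apply to it. The definitions below are
  those of the locale with the separation axiom dropped; the two lemmas about
  \<^locale>\<open>Metric_space\<close> say that they agree with the library for genuine metrics.\<close>

definition pm_open :: "'b set \<Rightarrow> ('b \<Rightarrow> 'b \<Rightarrow> real) \<Rightarrow> 'b set \<Rightarrow> bool" where
  "pm_open M d U \<longleftrightarrow> U \<subseteq> M \<and> (\<forall>x\<in>U. \<exists>r>0. \<forall>y\<in>M. d x y < r \<longrightarrow> y \<in> U)"

definition pm_topology :: "'b set \<Rightarrow> ('b \<Rightarrow> 'b \<Rightarrow> real) \<Rightarrow> 'b topology" where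
  "pm_topology M d = topology (pm_open M d)"

definition pm_totally_bounded :: "('b \<Rightarrow> 'b \<Rightarrow> real) \<Rightarrow> 'b set \<Rightarrow> bool" where
  "pm_totally_bounded d S \<longleftrightarrow>
     (\<forall>\<epsilon>>0. \<exists>K. finite K \<and> K \<subseteq> S \<and> S \<subseteq> (\<Union>x\<in>K. {y. d x y < \<epsilon>}))"

lemma istopology_pm_open: "istopology (pm_open M d)"
  unfolding istopology_def
proof (intro conjI allI impI)
  fix S T assume S: "pm_open M d S" and T: "pm_open M d T"
  show "pm_open M d (S \<inter> T)"
    unfolding pm_open_def
  proof (intro conjI ballI)
    show "S \<inter> T \<subseteq> M" using S by (auto simp: pm_open_def)
  next
    fix x assume x: "x \<in> S \<inter> T"
    obtain r where r: "r > 0" "\<forall>y\<in>M. d x y < r \<longrightarrow> y \<in> S"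
      using S x unfolding pm_open_def by blast
    obtain s where s: "s > 0" "\<forall>y\<in>M. d x y < s \<longrightarrow> y \<in> T"
      using T x unfolding pm_open_def by blast
    show "\<exists>r>0. \<forall>y\<in>M. d x y < r \<longrightarrow> y \<in> S \<inter> T"
      using r s by (intro exI[of _ "min r s"]) auto
  qed
next
  fix K assume K: "\<forall>U\<in>K. pm_open M d U"
  show "pm_open M d (\<Union>K)"
    unfolding pm_open_def
  proof (intro conjI ballI)
    show "\<Union>K \<subseteq> M" using K by (auto simp: pm_open_def)
  next
    fix x assume "x \<in> \<Union>K"
    then obtain U where U: "U \<in> K" "x \<in> U" by blast
    then obtain r where "r > 0" "\<forall>y\<in>M. d x y < r \<longrightarrow> y \<in> U"
      using K unfolding pm_open_def by blast
    with U show "\<exists>r>0. \<forall>y\<in>M. d x y < r \<longrightarrow> y \<in> \<Union>K"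
      by blast
  qed
qed

lemma openin_pm_topology: "openin (pm_topology M d) U \<longleftrightarrow> pm_open M d U"
  by (simp add: pm_topology_def istopology_pm_open)

lemma topspace_pm_topology: "topspace (pm_topology M d) = M"
proof -
  have "\<exists>r::real. 0 < r" by (rule exI[of _ 1]) simp
  then have "pm_open M d M" by (simp add: pm_open_def)
  moreover have "U \<subseteq> M" if "pm_open M d U" for U using that by (simp add: pm_open_def)
  ultimately show ?thesis unfolding topspace_def openin_pm_topology by auto
qed

lemma (in Metric_space) pm_topology_eq_mtopology: "pm_topology M d = mtopology"
proof -
  have "pm_open M d U \<longleftrightarrow> mopen U" for U
  proof (cases "U \<subseteq> M")
    case True
    have "(\<forall>y\<in>M. d x y < r \<longrightarrow> y \<in> U) \<longleftrightarrow> mball x r \<subseteq> U" if "x \<in> U" for x r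
      using True that by (auto simp: subset_iff)
    then show ?thesis
      using True unfolding pm_open_def mopen_def by (simp add: Ball_def)
  qed (simp add: pm_open_def mopen_def)
  then have "pm_open M d = mopen" by blast
  then show ?thesis by (simp add: pm_topology_def mtopology_def)
qed

lemma (in Metric_space) pm_totally_bounded_iff:
  assumes "S \<subseteq> M"
  shows "pm_totally_bounded d S \<longleftrightarrow> mtotally_bounded S"
proof -
  have "y \<in> (\<Union>x\<in>K. {y. d x y < \<epsilon>}) \<longleftrightarrow> y \<in> (\<Union>x\<in>K. mball x \<epsilon>)"
    if K: "K \<subseteq> S" and y: "y \<in> S" for K \<epsilon> y
  proof -
    have "x \<in> M" if "x \<in> K" for x using that K assms by (meson subsetD)
    moreover have "y \<in> M" using y assms by (rule subsetD[rotated])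
    ultimately show ?thesis by (simp cong: bex_cong)
  qed
  then have "S \<subseteq> (\<Union>x\<in>K. {y. d x y < \<epsilon>}) \<longleftrightarrow> S \<subseteq> (\<Union>x\<in>K. mball x \<epsilon>)"
    if "K \<subseteq> S" for K \<epsilon>
    using that unfolding subset_eq[of S] by (simp only: cong: ball_cong)
  then show ?thesis
    unfolding pm_totally_bounded_def mtotally_bounded_def
    by (simp only: cong: conj_cong)
qed

section \<open>Ky Fan metric and Hausdorff distance\<close>

definition ky_fan :: "'a measure \<Rightarrow> ('a \<Rightarrow> real) \<Rightarrow> ('a \<Rightarrow> real) \<Rightarrow> real" where
  "ky_fan \<mu> f g = Inf {\<epsilon>. 0 \<le> \<epsilon> \<and> measure \<mu> {x \<in> space \<mu>. \<bar>f x - g x\<bar> > \<epsilon>} \<le> \<epsilon>}"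

definition open_nbhd :: "'b set \<Rightarrow> real \<Rightarrow> ('b \<Rightarrow> 'b \<Rightarrow> real) \<Rightarrow> 'b set" where
  "open_nbhd A \<epsilon> d = {y. \<exists>a\<in>A. d a y < \<epsilon>}"

text \<open>The infimum is taken over a nonempty set whenever \<open>A\<close>, \<open>B\<close> are nonempty and \<open>d\<close> is bounded;
  the Ky Fan metric of a probability measure is bounded by 1.\<close>

definition hausdorff_distance :: "('b \<Rightarrow> 'b \<Rightarrow> real) \<Rightarrow> 'b set \<Rightarrow> 'b set \<Rightarrow> real" where
  "hausdorff_distance d A B = Inf {\<epsilon>. 0 < \<epsilon> \<and> A \<subseteq> open_nbhd B \<epsilon> d \<and> B \<subseteq> open_nbhd A \<epsilon> d}"

definition nonempty_closed_subsets :: "'b set \<Rightarrow> ('b \<Rightarrow> 'b \<Rightarrow> real) \<Rightarrow> 'b set set" where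
  "nonempty_closed_subsets M d = {C. closedin (pm_topology M d) C \<and> C \<noteq> {}}"

section \<open>Geometric data sets\<close>

definition data_dist :: "('a \<Rightarrow> real) set \<Rightarrow> 'a \<Rightarrow> 'a \<Rightarrow> real" where
  "data_dist F x y = (SUP f\<in>F. \<bar>f x - f y\<bar>)"

text \<open>The underlying set of the data set is the whole type \<open>'a\<close>. The boundedness assumption says
  that the supremum defining the distance is finite, which the real-valued \<^const>\<open>Sup\<close>
  does not enforce.\<close>

locale geometric_data_set =
  fixes F :: "('a \<Rightarrow> real) set" and \<mu> :: "'a measure"
  assumes F_nonempty: "F \<noteq> {}"
    and data_dist_finite: "\<And>x y. bdd_above ((\<lambda>f. \<bar>f x - f y\<bar>) ` F)"
    and metric: "Metric_space UNIV (data_dist F)"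
    and complete: "Metric_space.mcomplete UNIV (data_dist F)"
    and separable: "separable_space (Metric_space.mtopology UNIV (data_dist F))"
    and borel_sets:
      "sets \<mu> = sets (sigma UNIV {U. openin (Metric_space.mtopology UNIV (data_dist F)) U})"
    and prob: "prob_space \<mu>"
    and full_support:
      "\<And>U. openin (Metric_space.mtopology UNIV (data_dist F)) U \<Longrightarrow> U \<noteq> {} \<Longrightarrow> 0 < measure \<mu> U"

section \<open>Families of Lipschitz functions\<close>

definition Lip1 :: "(real \<Rightarrow> real) set" where
  "Lip1 = {p. 1-lipschitz_on UNIV p}"

text \<open>The topology on function types is the product topology, so \<^const>\<open>closed\<close> here and
  \<^const>\<open>closure\<close> below refer to pointwise convergence.\<close>

definition monoidal :: "(real \<Rightarrow> real) set \<Rightarrow> bool" where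
  "monoidal L \<longleftrightarrow> L \<subseteq> Lip1 \<and> id \<in> L \<and> (\<forall>p\<in>L. \<forall>q\<in>L. p \<circ> q \<in> L) \<and> closed L"

definition comp_fun :: "(real \<Rightarrow> real) set \<Rightarrow> ('a \<Rightarrow> real) \<Rightarrow> ('a \<Rightarrow> real) set" where
  "comp_fun L f = {p \<circ> f | p. p \<in> L}"

definition comp_family :: "(real \<Rightarrow> real) set \<Rightarrow> ('a \<Rightarrow> real) set \<Rightarrow> ('a \<Rightarrow> real) set" where
  "comp_family L F = {p \<circ> f | p f. p \<in> L \<and> f \<in> F}"

definition family_quotient ::
    "('a \<Rightarrow> real) set \<Rightarrow> (real \<Rightarrow> real) set \<Rightarrow> ('a \<Rightarrow> real) set set" where
  "family_quotient F L = {comp_fun L f | f. f \<in> F}"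

definition std_gaussian :: "real measure" where
  "std_gaussian = density lborel (\<lambda>x. ennreal (std_normal_density x))"

definition self_compact :: "(real \<Rightarrow> real) set \<Rightarrow> bool" where
  "self_compact L \<longleftrightarrow>
     compactin (pm_topology (nonempty_closed_subsets Lip1 (ky_fan std_gaussian))
                  (hausdorff_distance (ky_fan std_gaussian)))
       (family_quotient L L)"

definition L_closed :: "(real \<Rightarrow> real) set \<Rightarrow> ('a \<Rightarrow> real) set \<Rightarrow> bool" where
  "L_closed L F \<longleftrightarrow> comp_family L (closure F) \<subseteq> closure F"

definition Cov ::
    "('a \<Rightarrow> real) set \<Rightarrow> real \<Rightarrow> (real \<Rightarrow> real) set \<Rightarrow> 'a measure \<Rightarrow> enat" where
  "Cov G \<epsilon> L \<mu> =
     Inf {enat (card N) | N. finite N \<and> N \<subseteq> G \<and> G \<subseteq> open_nbhd (comp_family L N) \<epsilon> (ky_fan \<mu>)}"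

definition L_compact :: "(real \<Rightarrow> real) set \<Rightarrow> ('a \<Rightarrow> real) set \<Rightarrow> 'a measure \<Rightarrow> bool" where
  "L_compact L F \<mu> \<longleftrightarrow> L_closed L F \<and> (\<forall>\<epsilon>>0. Cov (closure F) \<epsilon> L \<mu> < \<infinity>)"

end

theory Submission
  imports Defs
begin

text \<open>Postcomposition with a 1-Lipschitz map does not increase the Ky Fan distance. Hence a finite net
  for \<open>L\<close>-compactness approximates every orbit \<open>L \<circ> f\<close> by some \<open>L \<circ> p \<circ> g\<close> with \<open>g\<close> in the net.
  Since a small Gaussian Ky Fan distance between 1-Lipschitz functions forces uniform closeness on
  bounded intervals, self-compactness lets \<open>p\<close> range over a finite set. For compactness, the Hausdorff
  distance inherits completeness from the closure of \<open>F\<close>, and the lower limit \<open>A\<close> of a Cauchy sequence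
  of \<open>L\<close>-invariant sets is closed and again \<open>L\<close>-invariant, so that \<open>A = L \<circ> A\<close>.\<close>

section \<open>Pseudometric spaces\<close>

text \<open>The sets \<open>comp_family L C\<close> are not shown to be closed, so the Hausdorff
  distance is taken on all nonempty subsets of \<open>closure F\<close>, where it is only a
  pseudometric and limits are not unique. The lower limit is the right choice among them because it
  is always closed and can therefore serve as its own generating set in (3). For total boundedness
  in (3), a closed set \<open>C\<close> is replaced by those net points whose orbits are close to
  orbits of points of \<open>C\<close>; a finite net has only finitely many nonempty subsets.
  Conversely, an orbit is generated by the singleton \<open>{f}\<close>, which is closed because
  full support makes the Ky Fan distance separate points of \<open>closure F\<close>. One mechanism
  serves both measures, the Gaussian one and \<open>\<mu>\<close>: a set of positive mass on which
  functions vary little cannot lie inside a set of smaller mass.\<close>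

definition pm_complete :: "('b \<Rightarrow> 'b \<Rightarrow> real) \<Rightarrow> 'b set \<Rightarrow> bool" where
  "pm_complete d S \<longleftrightarrow>
     (\<forall>\<sigma> :: nat \<Rightarrow> _. range \<sigma> \<subseteq> S \<longrightarrow> (\<forall>\<epsilon>>0. \<exists>N. \<forall>m\<ge>N. \<forall>n\<ge>N. d (\<sigma> m) (\<sigma> n) < \<epsilon>) \<longrightarrow>
          (\<exists>l\<in>S. \<forall>\<epsilon>>0. \<exists>N. \<forall>n\<ge>N. d (\<sigma> n) l < \<epsilon>))"

lemma pm_totally_boundedE:
  assumes "pm_totally_bounded d S" "0 < \<epsilon>"
  obtains K where "finite K" "K \<subseteq> S" "\<forall>y\<in>S. \<exists>x\<in>K. d x y < \<epsilon>"
proof -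
  have "\<exists>K. finite K \<and> K \<subseteq> S \<and> S \<subseteq> (\<Union>x\<in>K. {y. d x y < \<epsilon>})"
    using assms by (simp add: pm_totally_bounded_def)
  then obtain K where "finite K" "K \<subseteq> S" "S \<subseteq> (\<Union>x\<in>K. {y. d x y < \<epsilon>})" by blast
  then show ?thesis by (intro that[of K]) auto
qed

lemma pm_completeD:
  fixes \<sigma> :: "nat \<Rightarrow> 'b"
  assumes "pm_complete d S" "\<And>n. \<sigma> n \<in> S"
    and "\<forall>\<epsilon>>0. \<exists>N. \<forall>m\<ge>N. \<forall>n\<ge>N. d (\<sigma> m) (\<sigma> n) < \<epsilon>"
  shows "\<exists>l\<in>S. \<forall>\<epsilon>>0. \<exists>N. \<forall>n\<ge>N. d (\<sigma> n) l < \<epsilon>"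
proof -
  have "range \<sigma> \<subseteq> S" using assms(2) by blast
  with assms(1,3) show ?thesis by (simp add: pm_complete_def)
qed

locale pseudometric =
  fixes M :: "'b set" and d :: "'b \<Rightarrow> 'b \<Rightarrow> real"
  assumes nonneg: "\<And>x y. x \<in> M \<Longrightarrow> y \<in> M \<Longrightarrow> 0 \<le> d x y"
    and refl: "\<And>x. x \<in> M \<Longrightarrow> d x x = 0"
    and commute: "\<And>x y. x \<in> M \<Longrightarrow> y \<in> M \<Longrightarrow> d x y = d y x"
    and triangle: "\<And>x y z. x \<in> M \<Longrightarrow> y \<in> M \<Longrightarrow> z \<in> M \<Longrightarrow> d x z \<le> d x y + d y z"
begin

lemma subspace:
  assumes "S \<subseteq> M"
  shows "pseudometric S d"
  by unfold_locales (meson assms subsetD nonneg refl commute triangle)+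

text \<open>Centres outside \<open>S\<close> are harmless: a centre of an
  \<open>\<epsilon>/2\<close>-net with a point of \<open>S\<close> nearby is moved to such a point,
  which doubles the radius, and the other centres are dropped.\<close>

lemma pm_totally_boundedI:
  assumes S: "S \<subseteq> M"
    and net: "\<And>\<epsilon>. 0 < \<epsilon> \<Longrightarrow> \<exists>K. finite K \<and> K \<subseteq> M \<and> (\<forall>y\<in>S. \<exists>x\<in>K. d x y < \<epsilon>)"
  shows "pm_totally_bounded d S"
  unfolding pm_totally_bounded_def
proof (intro allI impI)
  fix \<epsilon> :: real assume "0 < \<epsilon>"
  then obtain K where K: "finite K" "K \<subseteq> M" "\<forall>y\<in>S. \<exists>x\<in>K. d x y < \<epsilon>/2"
    using net[of "\<epsilon>/2"] by auto
  define pick where "pick x = (SOME y. y \<in> S \<and> d x y < \<epsilon>/2)" for x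
  define K' where "K' = {x\<in>K. \<exists>y\<in>S. d x y < \<epsilon>/2}"
  have pick: "pick x \<in> S \<and> d x (pick x) < \<epsilon>/2" if "x \<in> K'" for x
    using that someI_ex[of "\<lambda>y. y \<in> S \<and> d x y < \<epsilon>/2"] by (auto simp: K'_def pick_def)
  have "\<exists>x\<in>K'. d (pick x) y < \<epsilon>" if y: "y \<in> S" for y
  proof -
    obtain x where x: "x \<in> K" "d x y < \<epsilon>/2" using K y by blast
    then have x': "x \<in> K'" using y by (auto simp: K'_def)
    have m: "x \<in> M" "y \<in> M" "pick x \<in> M" using x K S y pick[OF x'] by auto
    have "d (pick x) y \<le> d (pick x) x + d x y" using m triangle by blast
    also have "\<dots> < \<epsilon>" using pick[OF x'] x commute[of x "pick x"] m by auto
    finally show ?thesis using x' by blast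
  qed
  then have "S \<subseteq> (\<Union>x\<in>pick ` K'. {y. d x y < \<epsilon>})" by blast
  moreover have "pick ` K' \<subseteq> S" using pick by blast
  moreover have "finite (pick ` K')" using K by (simp add: K'_def)
  ultimately show "\<exists>K. finite K \<and> K \<subseteq> S \<and> S \<subseteq> (\<Union>x\<in>K. {y. d x y < \<epsilon>})" by blast
qed

lemma pm_totally_bounded_subset:
  assumes "pm_totally_bounded d S" "S \<subseteq> M" "T \<subseteq> S"
  shows "pm_totally_bounded d T"
proof (rule pm_totally_boundedI)
  show "T \<subseteq> M" using assms by blast
  fix \<epsilon> :: real assume "0 < \<epsilon>"
  with assms(1) obtain K where K: "finite K" "K \<subseteq> S" "\<forall>y\<in>S. \<exists>x\<in>K. d x y < \<epsilon>"
    by (rule pm_totally_boundedE)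
  have "\<forall>y\<in>T. \<exists>x\<in>K. d x y < \<epsilon>" using K(3) assms(3) by auto
  with K(1,2) show "\<exists>K. finite K \<and> K \<subseteq> M \<and> (\<forall>y\<in>T. \<exists>x\<in>K. d x y < \<epsilon>)"
    using assms(2) by (intro exI[of _ K]) (simp add: subset_trans)
qed

lemma pm_open_ball:
  assumes "x \<in> M"
  shows "pm_open M d {y\<in>M. d x y < r}"
  unfolding pm_open_def
proof (intro conjI ballI)
  fix y assume y: "y \<in> {y\<in>M. d x y < r}"
  show "\<exists>s>0. \<forall>z\<in>M. d y z < s \<longrightarrow> z \<in> {y\<in>M. d x y < r}"
    using y triangle[of x y] assms by (intro exI[of _ "r - d x y"]) fastforce
qed auto

lemma compactin_imp_pm_totally_bounded:
  assumes "compactin (pm_topology M d) S"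
  shows "pm_totally_bounded d S"
proof (rule pm_totally_boundedI)
  show S: "S \<subseteq> M" using assms by (simp add: compactin_def topspace_pm_topology)
  fix \<epsilon> :: real assume "0 < \<epsilon>"
  define B where "B x = {y\<in>M. d x y < \<epsilon>}" for x
  have "\<forall>U\<in>B ` M. openin (pm_topology M d) U"
    by (auto simp: openin_pm_topology B_def pm_open_ball)
  moreover have "S \<subseteq> \<Union>(B ` M)"
  proof
    fix x assume "x \<in> S"
    then have "x \<in> M" "x \<in> B x" using S refl \<open>0 < \<epsilon>\<close> by (auto simp: B_def subset_iff)
    then show "x \<in> \<Union>(B ` M)" by blast
  qed
  ultimately obtain \<V> where "finite \<V>" "\<V> \<subseteq> B ` M" "S \<subseteq> \<Union>\<V>"
    using assms unfolding compactin_def by meson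
  then obtain K where "finite K" "K \<subseteq> M" "\<V> = B ` K" by (metis finite_subset_image)
  with \<open>S \<subseteq> \<Union>\<V>\<close> show "\<exists>K. finite K \<and> K \<subseteq> M \<and> (\<forall>y\<in>S. \<exists>x\<in>K. d x y < \<epsilon>)"
    by (intro exI[of _ K]) (auto simp: B_def)
qed

text \<open>Choosing one representative of each class of points at distance zero yields a genuine metric
  space, to which the library theorem applies.\<close>

lemma compactin_if_complete_totally_bounded:
  assumes S: "S \<subseteq> M" and complete: "pm_complete d S" and tb: "pm_totally_bounded d S"
  shows "compactin (pm_topology M d) S"
proof -
  define rep where "rep x = (SOME y. y \<in> S \<and> d x y = 0)" for x
  have rep: "rep x \<in> S" "d x (rep x) = 0" if "x \<in> S" for x
    using that S refl someI[of "\<lambda>y. y \<in> S \<and> d x y = 0" x] by (auto simp: rep_def)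
  have SM: "x \<in> M" if "x \<in> S" for x using that S by blast
  \<comment> \<open>Points at distance zero have the same distances to all of \<open>S\<close>, so
    the two choices are made from the same predicate and coincide.\<close>
  have rep_eq: "rep x = rep y" if "x \<in> S" "y \<in> S" "d x y = 0" for x y
  proof -
    have "d x z = d y z" if "z \<in> S" for z
      using that \<open>d x y = 0\<close> SM[OF \<open>x \<in> S\<close>] SM[OF \<open>y \<in> S\<close>] SM[OF that]
        triangle[of x y z] triangle[of y x z] commute[of x y] by simp
    then have "(\<lambda>z. z \<in> S \<and> d x z = 0) = (\<lambda>z. z \<in> S \<and> d y z = 0)" by auto
    then show ?thesis unfolding rep_def by simp
  qed
  have rep_dist: "d x (rep y) = d x y" if "x \<in> S" "y \<in> S" for x y
    using SM[OF that(1)] SM[OF that(2)] rep[OF that(2)] SM[OF rep(1)[OF that(2)]]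
      triangle[of x y "rep y"] triangle[of x "rep y" y] commute[of y "rep y"] by simp
  have rep_dist': "d (rep x) y = d x y" if "x \<in> S" "y \<in> S" for x y
    using that rep_dist[of y x] SM[OF rep(1)[of x]] SM commute[of "rep x" y] commute[of x y] by simp
  let ?R = "rep ` S"
  have RS: "?R \<subseteq> S" using rep by blast
  \<comment> \<open>\<open>Metric_space\<close> asks for nonnegativity and symmetry at all points of
    the type, whereas \<open>d\<close> is controlled only on \<open>M\<close>; hence the value 0 off
    the representatives.\<close>
  interpret R: Metric_space ?R "\<lambda>x y. if x \<in> ?R \<and> y \<in> ?R then d x y else 0"
  proof
    fix x y
    have RM: "z \<in> M" if "z \<in> ?R" for z using that RS SM by blast
    show "0 \<le> (if x \<in> ?R \<and> y \<in> ?R then d x y else 0)"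
      using nonneg[OF RM RM] by simp
    show "(if x \<in> ?R \<and> y \<in> ?R then d x y else 0) = (if y \<in> ?R \<and> x \<in> ?R then d y x else 0)"
      using commute[OF RM RM] by simp
    assume xy: "x \<in> ?R" "y \<in> ?R"
    then obtain a b where ab: "a \<in> S" "b \<in> S" "x = rep a" "y = rep b" by blast
    have "d x y = d a b" using ab rep rep_dist rep_dist' by simp
    moreover have "d x x = 0" using xy RS SM refl by blast
    ultimately have "d x y = 0 \<longleftrightarrow> x = y" using ab rep_eq by auto
    then show "((if x \<in> ?R \<and> y \<in> ?R then d x y else 0) = 0) = (x = y)"
      using xy by simp
  next
    fix x y z assume xyz: "x \<in> ?R" "y \<in> ?R" "z \<in> ?R"
    then have "x \<in> M" "y \<in> M" "z \<in> M" using RS SM by blast+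
    with xyz show "(if x \<in> ?R \<and> z \<in> ?R then d x z else 0) \<le>
       (if x \<in> ?R \<and> y \<in> ?R then d x y else 0) + (if y \<in> ?R \<and> z \<in> ?R then d y z else 0)"
      using triangle[of x y z] by simp
  qed
  have "R.mcomplete"
    unfolding R.mcomplete_def
  proof (intro allI impI)
    fix \<sigma> assume \<sigma>: "R.MCauchy \<sigma>"
    then have r: "\<And>n. \<sigma> n \<in> ?R" by (auto simp: R.MCauchy_def)
    then have rS: "range \<sigma> \<subseteq> S" using RS by blast
    have "\<forall>\<epsilon>>0. \<exists>N. \<forall>m\<ge>N. \<forall>n\<ge>N. d (\<sigma> m) (\<sigma> n) < \<epsilon>"
      using \<sigma> r by (simp add: R.MCauchy_def)
    then obtain l where l: "l \<in> S" "\<forall>\<epsilon>>0. \<exists>N. \<forall>n\<ge>N. d (\<sigma> n) l < \<epsilon>"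
      using pm_completeD[OF complete, of \<sigma>] rS by blast
    have "\<forall>\<epsilon>>0. \<exists>N. \<forall>n\<ge>N. d (\<sigma> n) (rep l) < \<epsilon>"
      using l rS rep_dist by (simp add: image_subset_iff)
    then have "limitin R.mtopology \<sigma> (rep l) sequentially"
      using r l(1) by (simp add: R.limit_metric_sequentially)
    then show "\<exists>x. limitin R.mtopology \<sigma> x sequentially" by blast
  qed
  moreover have "R.mtotally_bounded ?R"
    unfolding R.mtotally_bounded_def
  proof (intro allI impI)
    fix \<epsilon> :: real assume "0 < \<epsilon>"
    with tb obtain K where K: "finite K" "K \<subseteq> S" "\<forall>y\<in>S. \<exists>x\<in>K. d x y < \<epsilon>"
      by (rule pm_totally_boundedE)
    have "?R \<subseteq> (\<Union>x\<in>rep ` K. R.mball x \<epsilon>)"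
    proof
      fix y assume y: "y \<in> ?R"
      then obtain x where x: "x \<in> K" "d x y < \<epsilon>" using K RS by blast
      then have "y \<in> R.mball (rep x) \<epsilon>"
        using y K RS by (auto simp: R.in_mball rep_dist' subset_iff)
      with x show "y \<in> (\<Union>x\<in>rep ` K. R.mball x \<epsilon>)" by blast
    qed
    then show "\<exists>K. finite K \<and> K \<subseteq> ?R \<and> ?R \<subseteq> (\<Union>x\<in>K. R.mball x \<epsilon>)"
      using K by (intro exI[of _ "rep ` K"]) auto
  qed
  ultimately have "compact_space R.mtopology"
    by (simp add: R.compact_space_eq_mcomplete_mtotally_bounded)
  then have comp: "compactin R.mtopology ?R" by (simp add: compact_space_def)
  show ?thesis
    unfolding compactin_def topspace_pm_topology
  proof (intro conjI allI impI)
    fix \<U> assume \<U>: "(\<forall>U\<in>\<U>. openin (pm_topology M d) U) \<and> S \<subseteq> \<Union>\<U>"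
    have trace_open: "openin R.mtopology (U \<inter> ?R)" if "U \<in> \<U>" for U
      unfolding R.openin_mtopology
    proof (intro conjI allI impI)
      fix x assume x: "x \<in> U \<inter> ?R"
      have "pm_open M d U" using \<U> that by (simp add: openin_pm_topology)
      then obtain r where r: "r > 0" "\<forall>y\<in>M. d x y < r \<longrightarrow> y \<in> U"
        using x unfolding pm_open_def by blast
      have "R.mball x r \<subseteq> U \<inter> ?R"
      proof
        fix y assume "y \<in> R.mball x r"
        then have "y \<in> ?R" "d x y < r" by (auto simp: R.in_mball)
        then show "y \<in> U \<inter> ?R" using r RS S by blast
      qed
      then show "\<exists>r>0. R.mball x r \<subseteq> U \<inter> ?R" using r by blast
    qed blast
    have "?R \<subseteq> \<Union>((\<lambda>U. U \<inter> ?R) ` \<U>)" using RS \<U> by blast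
    moreover have "\<forall>V\<in>(\<lambda>U. U \<inter> ?R) ` \<U>. openin R.mtopology V" using trace_open by simp
    ultimately have "\<exists>\<F>. finite \<F> \<and> \<F> \<subseteq> (\<lambda>U. U \<inter> ?R) ` \<U> \<and> ?R \<subseteq> \<Union>\<F>"
      using comp[unfolded compactin_def, THEN conjunct2, rule_format, of "(\<lambda>U. U \<inter> ?R) ` \<U>"]
      by simp
    then obtain \<V> where \<V>: "finite \<V>" "\<V> \<subseteq> \<U>" "?R \<subseteq> \<Union>((\<lambda>U. U \<inter> ?R) ` \<V>)"
      by (metis finite_subset_image)
    \<comment> \<open>An open set containing \<open>rep s\<close> also contains \<open>s\<close>,
      which lies at distance zero from it, so a cover of the representatives covers
      \<open>S\<close>.\<close>
    have "s \<in> \<Union>\<V>" if s: "s \<in> S" for s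
    proof -
      obtain U where U: "U \<in> \<V>" "rep s \<in> U" using \<V>(3) s by blast
      have "pm_open M d U" using \<U> \<V> U by (auto simp: openin_pm_topology)
      then obtain r where "r > 0" "\<forall>y\<in>M. d (rep s) y < r \<longrightarrow> y \<in> U"
        using U unfolding pm_open_def by blast
      moreover have "d (rep s) s = 0" using s rep_dist' refl SM by simp
      ultimately have "s \<in> U" using SM[OF s] by simp
      then show ?thesis using U by blast
    qed
    then show "\<exists>\<F>. finite \<F> \<and> \<F> \<subseteq> \<U> \<and> S \<subseteq> \<Union>\<F>" using \<V> by blast
  qed (rule S)
qed

end

section \<open>The Hausdorff distance\<close>

locale bounded_pseudometric = pseudometric +
  assumes bounded: "\<exists>B. \<forall>x\<in>M. \<forall>y\<in>M. d x y \<le> B"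
begin

lemma hausdorff_distance_le:
  assumes "0 < \<epsilon>" "A \<subseteq> open_nbhd B \<epsilon> d" "B \<subseteq> open_nbhd A \<epsilon> d"
  shows "hausdorff_distance d A B \<le> \<epsilon>"
  unfolding hausdorff_distance_def
  using assms by (intro cInf_lower bdd_belowI[of _ 0]) auto

lemma hausdorff_distance_less:
  assumes "A \<subseteq> M" "A \<noteq> {}" "B \<subseteq> M" "B \<noteq> {}" "hausdorff_distance d A B < \<epsilon>"
  shows "A \<subseteq> open_nbhd B \<epsilon> d" "B \<subseteq> open_nbhd A \<epsilon> d"
proof -
  let ?E = "{\<epsilon>. 0 < \<epsilon> \<and> A \<subseteq> open_nbhd B \<epsilon> d \<and> B \<subseteq> open_nbhd A \<epsilon> d}"
  obtain C where C: "\<And>x y. x \<in> M \<Longrightarrow> y \<in> M \<Longrightarrow> d x y \<le> C" using bounded by blast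
  \<comment> \<open>\<open>max 1 (C + 1)\<close> is positive and exceeds all distances. It is
    therefore an admissible radius, so the infimum is taken over a nonempty set and can be
    approached from within it.\<close>
  have small: "d x y < max 1 (C + 1)" if "x \<in> M" "y \<in> M" for x y using C[OF that] by linarith
  have nbhd: "X \<subseteq> open_nbhd Y (max 1 (C + 1)) d" if XY: "X \<subseteq> M" "Y \<subseteq> M" "Y \<noteq> {}" for X Y
  proof -
    obtain y where y: "y \<in> Y" using XY by blast
    then have "d y x < max 1 (C + 1)" if "x \<in> X" for x
      using that XY by (intro small) (simp_all add: subset_iff)
    then show ?thesis using y by (auto simp: open_nbhd_def)
  qed
  have "max 1 (C + 1) \<in> ?E" using nbhd assms(1-4) by simp
  then have "?E \<noteq> {}" by (metis empty_iff)
  then obtain e where "e \<in> ?E" "e < \<epsilon>"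
    using assms(5) cInf_lessD[of ?E \<epsilon>] unfolding hausdorff_distance_def by metis
  moreover have "open_nbhd X e d \<subseteq> open_nbhd X \<epsilon> d" for X
    using \<open>e < \<epsilon>\<close> by (force simp: open_nbhd_def)
  ultimately show "A \<subseteq> open_nbhd B \<epsilon> d" "B \<subseteq> open_nbhd A \<epsilon> d" by blast+
qed

lemma hausdorff_distance_nonneg:
  assumes "A \<subseteq> M" "A \<noteq> {}" "B \<subseteq> M" "B \<noteq> {}"
  shows "0 \<le> hausdorff_distance d A B"
proof (rule ccontr)
  assume "\<not> ?thesis"
  then have "A \<subseteq> open_nbhd B 0 d" using assms hausdorff_distance_less by simp
  then show False using assms nonneg unfolding open_nbhd_def by fastforce
qed

lemma open_nbhd_trans:
  assumes "A \<subseteq> M" "B \<subseteq> M" "C \<subseteq> M" "A \<subseteq> open_nbhd B e d" "B \<subseteq> open_nbhd C e' d"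
  shows "A \<subseteq> open_nbhd C (e' + e) d"
proof
  fix a assume a: "a \<in> A"
  then obtain b where b: "b \<in> B" "d b a < e" using assms by (auto simp: open_nbhd_def)
  then obtain c where c: "c \<in> C" "d c b < e'" using assms by (auto simp: open_nbhd_def)
  have "d c a \<le> d c b + d b a" using triangle a b c assms by blast
  with b c show "a \<in> open_nbhd C (e' + e) d" by (force simp: open_nbhd_def)
qed

lemma pseudometric_hausdorff_distance:
  "pseudometric {A. A \<subseteq> M \<and> A \<noteq> {}} (hausdorff_distance d)"
proof
  fix A assume A: "A \<in> {A. A \<subseteq> M \<and> A \<noteq> {}}"
  have "hausdorff_distance d A A \<le> \<epsilon>" if "0 < \<epsilon>" for \<epsilon>
    using that A refl by (intro hausdorff_distance_le) (auto simp: open_nbhd_def subset_iff intro!: bexI)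
  then have "hausdorff_distance d A A \<le> 0" by (rule field_le_epsilon[where y = 0, simplified])
  then show "hausdorff_distance d A A = 0"
    using A hausdorff_distance_nonneg[of A A] by (intro antisym) simp_all
next
  fix A B show "hausdorff_distance d A B = hausdorff_distance d B A"
    unfolding hausdorff_distance_def by (rule arg_cong[of _ _ Inf]) auto
next
  fix A B C assume "A \<in> {A. A \<subseteq> M \<and> A \<noteq> {}}" "B \<in> {A. A \<subseteq> M \<and> A \<noteq> {}}" "C \<in> {A. A \<subseteq> M \<and> A \<noteq> {}}"
  then have A: "A \<subseteq> M" "A \<noteq> {}" and B: "B \<subseteq> M" "B \<noteq> {}" and C: "C \<subseteq> M" "C \<noteq> {}" by auto
  show "hausdorff_distance d A C \<le> hausdorff_distance d A B + hausdorff_distance d B C"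
  proof (rule field_le_epsilon)
    fix e :: real assume e: "0 < e"
    let ?a = "hausdorff_distance d A B + e/2" and ?b = "hausdorff_distance d B C + e/2"
    have 1: "A \<subseteq> open_nbhd B ?a d" "B \<subseteq> open_nbhd A ?a d"
      "B \<subseteq> open_nbhd C ?b d" "C \<subseteq> open_nbhd B ?b d"
      using hausdorff_distance_less[OF A B] hausdorff_distance_less[OF B C] e by simp_all
    have "hausdorff_distance d A C \<le> ?a + ?b"
    proof (rule hausdorff_distance_le)
      show "0 < ?a + ?b"
        using hausdorff_distance_nonneg[OF A B] hausdorff_distance_nonneg[OF B C] e by linarith
      show "A \<subseteq> open_nbhd C (?a + ?b) d" "C \<subseteq> open_nbhd A (?a + ?b) d"
        using open_nbhd_trans[OF A(1) B(1) C(1) 1(1,3)] open_nbhd_trans[OF C(1) B(1) A(1) 1(4,2)]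
        by (simp_all add: add.commute)
    qed
    then show "hausdorff_distance d A C \<le> hausdorff_distance d A B + hausdorff_distance d B C + e"
      by simp
  qed
qed (use hausdorff_distance_nonneg in auto)


section \<open>Lower limits of Hausdorff Cauchy sequences\<close>

text \<open>This is the lower Kuratowski limit: the points whose distance to \<open>\<A> n\<close>
  tends to zero.\<close>

definition liminf_set :: "(nat \<Rightarrow> 'a set) \<Rightarrow> 'a set" where
  "liminf_set \<A> = {x\<in>M. \<forall>\<epsilon>>0. \<exists>N. \<forall>n\<ge>N. x \<in> open_nbhd (\<A> n) \<epsilon> d}"

lemma closedin_liminf_set:
  assumes "\<And>n. \<A> n \<subseteq> M"
  shows "closedin (pm_topology M d) (liminf_set \<A>)"
  unfolding closedin_def topspace_pm_topology openin_pm_topology pm_open_def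
proof (intro conjI ballI)
  fix x assume x: "x \<in> M - liminf_set \<A>"
  then obtain \<epsilon> where \<epsilon>: "\<epsilon> > 0" "\<And>N. \<exists>n\<ge>N. x \<notin> open_nbhd (\<A> n) \<epsilon> d"
    by (auto simp: liminf_set_def)
  have "y \<notin> liminf_set \<A>" if y: "y \<in> M" "d x y < \<epsilon>/2" for y
  proof
    assume "y \<in> liminf_set \<A>"
    then obtain N where N: "\<forall>n\<ge>N. y \<in> open_nbhd (\<A> n) (\<epsilon>/2) d"
      using \<epsilon>(1) by (auto simp: liminf_set_def dest: spec[of _ "\<epsilon>/2"])
    obtain n where n: "n \<ge> N" "x \<notin> open_nbhd (\<A> n) \<epsilon> d" using \<epsilon>(2) by blast
    obtain a where a: "a \<in> \<A> n" "d a y < \<epsilon>/2" using N n by (auto simp: open_nbhd_def)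
    have "a \<in> M" using a assms by blast
    then have "d a x \<le> d a y + d x y" using triangle[of a y x] commute[of x y] x y by simp
    then show False using a n y by (force simp: open_nbhd_def)
  qed
  then show "\<exists>r>0. \<forall>y\<in>M. d x y < r \<longrightarrow> y \<in> M - liminf_set \<A>"
    using \<epsilon> by (intro exI[of _ "\<epsilon>/2"]) auto
qed (auto simp: liminf_set_def)

text \<open>Starting from a point of a late set, one walks through later and later sets with steps
  below \<open>\<epsilon> / 2^i\<close>. The walk converges to a point of the lower limit, at
  distance at most \<open>2 * \<epsilon>\<close> from the start. This gives nonemptiness and one of
  the two inclusions; the other follows from the definition of the lower limit and the Cauchy
  property.\<close>

lemma hausdorff_Cauchy_liminf_set:
  assumes complete: "pm_complete d M"
    and sub: "\<And>n. \<A> n \<subseteq> M" "\<And>n. \<A> n \<noteq> {}"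
    and Cauchy: "\<forall>\<epsilon>>0. \<exists>N. \<forall>m\<ge>N. \<forall>n\<ge>N. hausdorff_distance d (\<A> m) (\<A> n) < \<epsilon>"
  shows "liminf_set \<A> \<noteq> {}"
    and "\<forall>\<epsilon>>0. \<exists>N. \<forall>n\<ge>N. hausdorff_distance d (\<A> n) (liminf_set \<A>) < \<epsilon>"
proof -
  have near: "\<exists>b\<in>\<A> n. d a b < \<epsilon>" 
    if a: "a \<in> \<A> m" and less: "hausdorff_distance d (\<A> m) (\<A> n) < \<epsilon>" for a m n \<epsilon>
  proof -
    obtain b where "b \<in> \<A> n" "d b a < \<epsilon>"
      using hausdorff_distance_less(1)[OF sub(1,2)[of m] sub(1,2)[of n] less] a
      by (auto simp: open_nbhd_def)
    then show ?thesis using commute[of a b] a sub(1) by (metis subsetD)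
  qed
  have approx: "\<exists>x\<in>liminf_set \<A>. d a x < 3 * \<epsilon>"
    if \<epsilon>: "\<epsilon> > 0" and N: "\<forall>m\<ge>N. \<forall>n\<ge>N. hausdorff_distance d (\<A> m) (\<A> n) < \<epsilon>"
      and a: "a \<in> \<A> n" "n \<ge> N" for a n N \<epsilon>
  proof -
    have "\<forall>i::nat. \<exists>K. \<forall>m\<ge>K. \<forall>n\<ge>K. hausdorff_distance d (\<A> m) (\<A> n) < \<epsilon> / 2^i"
      using Cauchy \<epsilon> by simp
    then obtain K where K: "\<And>i m n. m \<ge> K i \<Longrightarrow> n \<ge> K i \<Longrightarrow>
        hausdorff_distance d (\<A> m) (\<A> n) < \<epsilon> / 2^i" by metis
    \<comment> \<open>Summing the thresholds makes \<open>k\<close> increasing and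
      \<open>k i \<ge> K i\<close> for positive \<open>i\<close>. Index 0 is exactly
      \<open>n\<close>, so that the walk can start at \<open>a\<close>; there the bound
      \<open>\<epsilon>\<close> comes from \<open>N\<close> instead of \<open>K\<close>.\<close>
    define k where "k i = (if i = 0 then n else n + (\<Sum>j\<le>i. K j))" for i
    have kK: "k i \<ge> K i" if "i > 0" for i
      using that member_le_sum[of i "{..i}" K] by (simp add: k_def)
    have k: "hausdorff_distance d (\<A> (k i)) (\<A> m) < \<epsilon> / 2^i" if "m \<ge> k i" for i m
    proof (cases "i = 0")
      case True then show ?thesis using that N a by (simp add: k_def)
    next
      case False then show ?thesis using that K kK[of i] by simp
    qed
    have k_mono: "k i \<le> k (Suc i)" for i by (simp add: k_def)
    \<comment> \<open>Dependent choice of the walk; the clause for \<open>i = 0\<close> pins its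
      starting point to \<open>a\<close>.\<close>
    have "\<exists>f. \<forall>i. (f i \<in> \<A> (k i) \<and> (i = 0 \<longrightarrow> f i = a)) \<and> d (f i) (f (Suc i)) < \<epsilon> / 2^i"
    proof (rule dependent_nat_choice)
      show "\<exists>x. x \<in> \<A> (k 0) \<and> (0 = 0 \<longrightarrow> x = a)" using a by (simp add: k_def)
    next
      fix x i assume "x \<in> \<A> (k i) \<and> (i = 0 \<longrightarrow> x = a)"
      then show "\<exists>y. (y \<in> \<A> (k (Suc i)) \<and> (Suc i = 0 \<longrightarrow> y = a)) \<and> d x y < \<epsilon> / 2^i"
        using near[of x "k i" "k (Suc i)"] k[OF k_mono] by blast
    qed
    then obtain f where f: "\<And>i. f i \<in> \<A> (k i)" "f 0 = a" "\<And>i. d (f i) (f (Suc i)) < \<epsilon> / 2^i"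
      by metis
    have fM: "f i \<in> M" for i using f(1) sub(1) by blast
    \<comment> \<open>The factor on the right is the exact partial sum of the geometric series of
      step bounds, which makes the induction close.\<close>
    have tail: "d (f i) (f (i + j)) \<le> 2 * \<epsilon> / 2^i * (1 - 1 / 2^j)" for i j
    proof (induction j)
      case 0 show ?case using refl fM by simp
    next
      case (Suc j)
      have "d (f i) (f (i + Suc j)) \<le> d (f i) (f (i + j)) + d (f (i + j)) (f (Suc (i + j)))"
        using triangle fM by simp
      also have "\<dots> \<le> 2 * \<epsilon> / 2^i * (1 - 1 / 2^j) + \<epsilon> / 2^(i + j)"
        using Suc f(3)[of "i + j"] by simp
      also have "\<dots> = 2 * \<epsilon> / 2^i * (1 - 1 / 2^Suc j)"
        by (simp add: field_simps power_add)
      finally show ?case .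
    qed
    have tail': "d (f i) (f j) \<le> 2 * \<epsilon> / 2^i" if "i \<le> j" for i j
    proof -
      have "2 * \<epsilon> / 2^i * (1 - 1 / 2^(j - i)) \<le> 2 * \<epsilon> / 2^i * 1"
        using \<epsilon> by (intro mult_left_mono) auto
      then show ?thesis using tail[of i "j - i"] that by simp
    qed
    have small: "\<exists>i. c / 2^i < \<eta>" if "\<eta> > 0" for c \<eta> :: real
    proof -
      have "(\<lambda>i. c * (1/2)^i) \<longlonglongrightarrow> c * 0" by (intro tendsto_mult LIMSEQ_power_zero) auto
      then have "eventually (\<lambda>i. c * (1/2)^i < \<eta>) sequentially"
        using that by (intro order_tendstoD) auto
      then show ?thesis by (auto simp: eventually_sequentially power_divide)
    qed
    have "\<exists>N. \<forall>m\<ge>N. \<forall>n\<ge>N. d (f m) (f n) < \<eta>" if \<eta>: "\<eta> > 0" for \<eta>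
    proof -
      \<comment> \<open>Both points are compared with \<open>f i\<close>, at a cost of at most
        \<open>2 * \<epsilon> / 2^i\<close> each.\<close>
      obtain i where i: "4 * \<epsilon> / 2^i < \<eta>" using small[OF \<eta>] by blast
      have "d (f m) (f n) < \<eta>" if "m \<ge> i" "n \<ge> i" for m n
        using triangle[of "f m" "f i" "f n"] fM commute[of "f m" "f i"] tail'[of i m] tail'[of i n]
          that i by simp
      then show ?thesis by blast
    qed
    then obtain x where x: "x \<in> M" "\<forall>\<eta>>0. \<exists>N. \<forall>n\<ge>N. d (f n) x < \<eta>"
      using pm_completeD[of d M f] complete fM by auto
    have "d (f i) x \<le> 2 * \<epsilon> / 2^i" for i
    proof (rule field_le_epsilon)
      fix e :: real assume "0 < e"
      then obtain N where "\<forall>n\<ge>N. d (f n) x < e" using x by blast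
      then have "d (f (max N i)) x < e" by simp
      then show "d (f i) x \<le> 2 * \<epsilon> / 2^i + e"
        using triangle[of "f i" "f (max N i)" x] fM x tail'[of i "max N i"] by fastforce
    qed
    note lim = this
    have "x \<in> liminf_set \<A>"
      unfolding liminf_set_def
    proof (intro CollectI conjI allI impI x(1))
      fix \<eta> :: real assume "\<eta> > 0"
      \<comment> \<open>One unit of \<open>\<epsilon> / 2^i\<close> pays for passing from
        \<open>f i\<close> to a point of \<open>\<A> m\<close>, two units for the distance from
        \<open>f i\<close> to the limit.\<close>
      then obtain i where i: "3 * \<epsilon> / 2^i < \<eta>" using small by blast
      have "x \<in> open_nbhd (\<A> m) \<eta> d" if m: "m \<ge> k i" for m
      proof -
        obtain b where b: "b \<in> \<A> m" "d (f i) b < \<epsilon> / 2^i"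
          using near[OF f(1) k[OF m]] by blast
        have "b \<in> M" using b sub by blast
        then have "d b x \<le> d (f i) b + d (f i) x"
          using triangle[of b "f i" x] commute[of b "f i"] fM x by simp
        also have "\<dots> < \<eta>" using b i lim[of i] by simp
        finally show ?thesis using b by (auto simp: open_nbhd_def)
      qed
      then show "\<exists>N. \<forall>n\<ge>N. x \<in> open_nbhd (\<A> n) \<eta> d" by blast
    qed
    moreover have "d a x < 3 * \<epsilon>" using lim[of 0] f(2) \<epsilon> by simp
    ultimately show ?thesis by blast
  qed
  show "liminf_set \<A> \<noteq> {}"
  proof -
    obtain N where "\<forall>m\<ge>N. \<forall>n\<ge>N. hausdorff_distance d (\<A> m) (\<A> n) < 1"
      using Cauchy zero_less_one by blast
    then show ?thesis using approx[of 1 N _ N] sub(2)[of N] by auto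
  qed
  show "\<forall>\<epsilon>>0. \<exists>N. \<forall>n\<ge>N. hausdorff_distance d (\<A> n) (liminf_set \<A>) < \<epsilon>"
  proof (intro allI impI)
    fix e :: real assume e: "0 < e"
    define \<epsilon> where "\<epsilon> = e / 4"
    have \<epsilon>: "\<epsilon> > 0" using e by (simp add: \<epsilon>_def)
    obtain N where N: "\<forall>m\<ge>N. \<forall>n\<ge>N. hausdorff_distance d (\<A> m) (\<A> n) < \<epsilon>"
      using Cauchy \<epsilon> by blast
    have "hausdorff_distance d (\<A> n) (liminf_set \<A>) \<le> 3 * \<epsilon>" if n: "n \<ge> N" for n
    proof (rule hausdorff_distance_le)
      show "0 < 3 * \<epsilon>" using \<epsilon> by simp
      show "\<A> n \<subseteq> open_nbhd (liminf_set \<A>) (3 * \<epsilon>) d"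
      proof
        fix a assume a: "a \<in> \<A> n"
        then obtain x where x: "x \<in> liminf_set \<A>" "d a x < 3 * \<epsilon>" using approx \<epsilon> N n by blast
        moreover have "d x a = d a x"
          using x a sub(1) by (intro commute) (auto simp: liminf_set_def)
        ultimately have "d x a < 3 * \<epsilon>" by simp
        with x(1) show "a \<in> open_nbhd (liminf_set \<A>) (3 * \<epsilon>) d" by (auto simp: open_nbhd_def)
      qed
      show "liminf_set \<A> \<subseteq> open_nbhd (\<A> n) (3 * \<epsilon>) d"
      proof
        fix x assume x: "x \<in> liminf_set \<A>"
        then obtain N' where "\<forall>n\<ge>N'. x \<in> open_nbhd (\<A> n) \<epsilon> d"
          using \<epsilon> by (auto simp: liminf_set_def)
        \<comment> \<open>At stage \<open>max N N'\<close> the point \<open>x\<close> is already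
          approximated, and the Cauchy estimate moves the approximating point into
          \<open>\<A> n\<close>.\<close>
        then have "x \<in> open_nbhd (\<A> (max N N')) \<epsilon> d" by simp
        then obtain a where a: "a \<in> \<A> (max N N')" "d a x < \<epsilon>" by (auto simp: open_nbhd_def)
        obtain b where b: "b \<in> \<A> n" "d a b < \<epsilon>" 
          using near[OF a(1), of n \<epsilon>] N n by auto
        have m: "a \<in> M" "b \<in> M" "x \<in> M" using a b x sub by (auto simp: liminf_set_def)
        have "d b x < 3 * \<epsilon>" using triangle[of b a x] commute[of a b] m a b \<epsilon> by simp
        then show "x \<in> open_nbhd (\<A> n) (3 * \<epsilon>) d" using b by (auto simp: open_nbhd_def)
      qed
    qed
    then show "\<exists>N. \<forall>n\<ge>N. hausdorff_distance d (\<A> n) (liminf_set \<A>) < e"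
      using \<epsilon> by (intro exI[of _ N]) (fastforce simp: \<epsilon>_def)
  qed
qed

end

section \<open>The Ky Fan metric\<close>

lemma ky_fan_le:
  assumes "0 \<le> \<epsilon>" "measure M {x\<in>space M. \<bar>f x - g x\<bar> > \<epsilon>} \<le> \<epsilon>"
  shows "ky_fan M f g \<le> \<epsilon>"
  unfolding ky_fan_def using assms by (intro cInf_lower bdd_belowI[of _ 0]) auto

context prob_space
begin

lemma ky_fan_set_nonempty: "{\<epsilon>. 0 \<le> \<epsilon> \<and> prob {x\<in>space M. \<bar>f x - g x\<bar> > \<epsilon>} \<le> \<epsilon>} \<noteq> {}"
  using prob_le_1[of "{x\<in>space M. \<bar>f x - g x\<bar> > 1}"] by (auto intro!: exI[of _ 1])

lemma ky_fan_nonneg: "0 \<le> ky_fan M f g"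
  unfolding ky_fan_def using ky_fan_set_nonempty by (intro cInf_greatest) auto

lemma ky_fan_le_1: "ky_fan M f g \<le> 1"
  using prob_le_1 by (intro ky_fan_le) auto

text \<open>Some admissible radius lies below \<open>\<epsilon>\<close>, and enlarging a radius
  shrinks the tail event. Ky Fan estimates are used below in this form.\<close>

lemma prob_gt_if_ky_fan_less:
  assumes [measurable]: "f \<in> borel_measurable M" "g \<in> borel_measurable M"
    and less: "ky_fan M f g < \<epsilon>"
  shows "prob {x\<in>space M. \<bar>f x - g x\<bar> > \<epsilon>} < \<epsilon>"
proof -
  obtain e where e: "0 \<le> e" "prob {x\<in>space M. \<bar>f x - g x\<bar> > e} \<le> e" "e < \<epsilon>"
    using cInf_lessD[OF ky_fan_set_nonempty less[unfolded ky_fan_def]] by auto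
  have "prob {x\<in>space M. \<bar>f x - g x\<bar> > \<epsilon>} \<le> prob {x\<in>space M. \<bar>f x - g x\<bar> > e}"
    using e by (intro finite_measure_mono) auto
  with e show ?thesis by simp
qed

lemma ky_fan_mono:
  assumes [measurable]: "f \<in> borel_measurable M" "g \<in> borel_measurable M"
    and le: "\<And>x. x \<in> space M \<Longrightarrow> \<bar>f' x - g' x\<bar> \<le> \<bar>f x - g x\<bar>"
  shows "ky_fan M f' g' \<le> ky_fan M f g"
proof (rule field_le_epsilon)
  fix e :: real assume e: "0 < e"
  let ?\<epsilon> = "ky_fan M f g + e"
  have "prob {x\<in>space M. \<bar>f' x - g' x\<bar> > ?\<epsilon>} \<le> prob {x\<in>space M. \<bar>f x - g x\<bar> > ?\<epsilon>}"
    using le by (intro finite_measure_mono) (auto intro: less_le_trans)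
  also have "\<dots> < ?\<epsilon>" using e by (intro prob_gt_if_ky_fan_less) auto
  finally show "ky_fan M f' g' \<le> ?\<epsilon>"
    using e ky_fan_nonneg[of f g] by (intro ky_fan_le) auto
qed

lemma bounded_pseudometric_ky_fan:
  assumes "S \<subseteq> borel_measurable M"
  shows "bounded_pseudometric S (ky_fan M)"
proof
  fix f assume "f \<in> S"
  have "ky_fan M f f \<le> 0" by (rule ky_fan_le) auto
  then show "ky_fan M f f = 0" using ky_fan_nonneg[of f f] by simp
next
  fix f g show "ky_fan M f g = ky_fan M g f"
    by (simp add: ky_fan_def abs_minus_commute)
next
  fix f g h assume "f \<in> S" "g \<in> S" "h \<in> S"
  then have [measurable]: "f \<in> borel_measurable M" "g \<in> borel_measurable M" "h \<in> borel_measurable M"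
    using assms by auto
  show "ky_fan M f h \<le> ky_fan M f g + ky_fan M g h"
  proof (rule field_le_epsilon)
    fix e :: real assume e: "0 < e"
    let ?a = "ky_fan M f g + e/2" and ?b = "ky_fan M g h + e/2"
    have "prob {x\<in>space M. \<bar>f x - h x\<bar> > ?a + ?b}
        \<le> prob ({x\<in>space M. \<bar>f x - g x\<bar> > ?a} \<union> {x\<in>space M. \<bar>g x - h x\<bar> > ?b})"
      by (intro finite_measure_mono) auto
    also have "\<dots> \<le> prob {x\<in>space M. \<bar>f x - g x\<bar> > ?a} + prob {x\<in>space M. \<bar>g x - h x\<bar> > ?b}"
      by (intro measure_Un_le) auto
    also have "\<dots> \<le> ?a + ?b"
      using e by (intro add_mono less_imp_le prob_gt_if_ky_fan_less) auto
    finally have "ky_fan M f h \<le> ?a + ?b"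
      using e ky_fan_nonneg[of f g] ky_fan_nonneg[of g h] by (intro ky_fan_le) auto
    then show "ky_fan M f h \<le> ky_fan M f g + ky_fan M g h + e" by simp
  qed
next
  show "\<exists>B. \<forall>f\<in>S. \<forall>g\<in>S. ky_fan M f g \<le> B" using ky_fan_le_1 by blast
qed (rule ky_fan_nonneg)

text \<open>The event where \<open>f\<close> and \<open>g\<close> differ by more than
  \<open>\<delta>\<close> is too small to contain \<open>B\<close>. At a point of \<open>B\<close>
  outside it the values are within \<open>\<delta>\<close>, and moving to \<open>x\<close> costs at
  most \<open>r\<close> for each function: three summands, each at most \<open>r\<close>.\<close>

lemma abs_diff_le_if_ky_fan_less:
  assumes [measurable]: "f \<in> borel_measurable M" "g \<in> borel_measurable M"
    and "ky_fan M f g < \<delta>" "\<delta> \<le> r" "B \<in> events" "\<delta> \<le> prob B"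
    and osc: "\<And>y. y \<in> B \<Longrightarrow> \<bar>f y - f x\<bar> \<le> r" "\<And>y. y \<in> B \<Longrightarrow> \<bar>g y - g x\<bar> \<le> r"
  shows "\<bar>f x - g x\<bar> \<le> 3 * r"
proof -
  have "prob {x\<in>space M. \<bar>f x - g x\<bar> > \<delta>} < prob B"
    using prob_gt_if_ky_fan_less[OF assms(1-3)] assms(6) by simp
  then have "\<not> B \<subseteq> {x\<in>space M. \<bar>f x - g x\<bar> > \<delta>}"
    using finite_measure_mono[of B "{x\<in>space M. \<bar>f x - g x\<bar> > \<delta>}"] by fastforce
  then obtain y where "y \<in> B" "\<bar>f y - g y\<bar> \<le> \<delta>"
    using sets.sets_into_space[OF assms(5)] by force
  then show ?thesis using osc[of y] assms(4) by linarith
qed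

text \<open>Pointwise convergence gives convergence in measure: the indicators of the deviation
  events tend to zero and are dominated by 1. The threshold \<open>\<epsilon>/2\<close> leaves room
  for the strict inequality.\<close>

lemma ky_fan_small_if_tendsto:
  assumes [measurable]: "\<And>n. f n \<in> borel_measurable M" "g \<in> borel_measurable M"
    and lim: "\<And>x. (\<lambda>n. f n x) \<longlonglongrightarrow> g x" and "0 < \<epsilon>"
  shows "\<exists>N. \<forall>n\<ge>N. ky_fan M (f n) g < \<epsilon>"
proof -
  define A where "A n = {x\<in>space M. \<bar>f n x - g x\<bar> > \<epsilon>/2}" for n
  have [measurable]: "A n \<in> events" for n unfolding A_def by measurable
  have "(\<lambda>n. \<integral>x. indicator (A n) x \<partial>M) \<longlonglongrightarrow> (\<integral>x. 0 \<partial>M :: real)"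
  proof (rule integral_dominated_convergence[where w = "\<lambda>_. 1"])
    show "AE x in M. (\<lambda>n. indicator (A n) x) \<longlonglongrightarrow> (0::real)"
    proof (rule AE_I2)
      fix x
      have "(\<lambda>n. \<bar>f n x - g x\<bar>) \<longlonglongrightarrow> \<bar>g x - g x\<bar>" by (intro tendsto_intros lim)
      then have "\<forall>\<^sub>F n in sequentially. \<bar>f n x - g x\<bar> < \<epsilon>/2"
        using \<open>0 < \<epsilon>\<close> by (intro order_tendstoD) auto
      then have "\<forall>\<^sub>F n in sequentially. indicator (A n) x = (0::real)"
        by eventually_elim (auto simp: A_def indicator_def)
      then show "(\<lambda>n. indicator (A n) x) \<longlonglongrightarrow> (0::real)" by (rule tendsto_eventually)
    qed
  qed (auto simp: indicator_def)
  then have "(\<lambda>n. prob (A n)) \<longlonglongrightarrow> 0" by simp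
  then have "\<forall>\<^sub>F n in sequentially. prob (A n) < \<epsilon>/2"
    using \<open>0 < \<epsilon>\<close> by (intro order_tendstoD) auto
  then obtain N where "\<forall>n\<ge>N. prob (A n) < \<epsilon>/2" by (auto simp: eventually_sequentially)
  then have "ky_fan M (f n) g < \<epsilon>" if "n \<ge> N" for n
    using ky_fan_le[of "\<epsilon>/2" M "f n" g] that \<open>0 < \<epsilon>\<close> by (force simp: A_def)
  then show ?thesis by blast
qed

text \<open>Tightness of the law of \<open>g\<close>: the tail events decrease to the empty
  set.\<close>

lemma ex_prob_abs_gt_less:
  fixes g :: "'a \<Rightarrow> real"
  assumes [measurable]: "g \<in> borel_measurable M" and "0 < \<epsilon>"
  shows "\<exists>R. prob {x\<in>space M. \<bar>g x\<bar> > R} < \<epsilon>"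
proof -
  define A where "A n = {x\<in>space M. \<bar>g x\<bar> > real n}" for n
  have "(\<lambda>n. prob (A n)) \<longlonglongrightarrow> prob (\<Inter>n. A n)"
    by (rule finite_Lim_measure_decseq) (auto simp: A_def decseq_def)
  also have "(\<Inter>n. A n) = {}"
  proof -
    have "\<exists>n. x \<notin> A n" for x
      using reals_Archimedean2[of "\<bar>g x\<bar>"] by (auto simp: A_def not_less intro: less_imp_le)
    then show ?thesis by blast
  qed
  finally have "\<forall>\<^sub>F n in sequentially. prob (A n) < \<epsilon>"
    using \<open>0 < \<epsilon>\<close> by (intro order_tendstoD) auto
  then obtain n where "prob (A n) < \<epsilon>" by (auto simp: eventually_sequentially)
  then show ?thesis by (auto simp: A_def)
qed

end

section \<open>Lipschitz functions and the Gaussian measure\<close>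

lemma Lip1_abs_le: "p \<in> Lip1 \<Longrightarrow> \<bar>p x - p y\<bar> \<le> \<bar>x - y\<bar>"
  using lipschitz_onD[of 1 UNIV p x y] by (simp add: Lip1_def dist_real_def)

lemma Lip1_borel_measurable: "p \<in> Lip1 \<Longrightarrow> p \<in> borel_measurable borel"
  by (intro borel_measurable_continuous_onI lipschitz_on_continuous_on) (auto simp: Lip1_def)

lemma sets_std_gaussian [simp, measurable_cong]: "sets std_gaussian = sets borel"
  by (simp add: std_gaussian_def)

lemma prob_space_std_gaussian: "prob_space std_gaussian"
  unfolding std_gaussian_def by (rule prob_space_normal_density) simp

text \<open>The density decreases in the modulus, so on each of these intervals it is at least its
  value at \<open>\<bar>R\<bar> + r\<close>; the length \<open>2 * r\<close> does the rest. The
  bound is uniform in \<open>x\<close>.\<close>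

lemma std_gaussian_interval_ge:
  assumes "0 < r"
  shows "\<exists>c>0. \<forall>x. \<bar>x\<bar> \<le> R \<longrightarrow> c \<le> measure std_gaussian {x - r<..<x + r}"
proof (intro exI conjI allI impI)
  interpret prob_space std_gaussian by (rule prob_space_std_gaussian)
  let ?m = "std_normal_density (\<bar>R\<bar> + r)"
  have m: "0 < ?m" by (simp add: normal_density_pos)
  then show "0 < ?m * (2 * r)" using assms by simp
  fix x assume x: "\<bar>x\<bar> \<le> R"
  let ?I = "{x - r<..<x + r}"
  have le: "?m \<le> std_normal_density y" if "y \<in> ?I" for y
  proof -
    have "y\<^sup>2 \<le> (\<bar>R\<bar> + r)\<^sup>2" using that x by (intro power2_le_iff_abs_le[THEN iffD2]) auto
    then show ?thesis by (simp add: std_normal_density_def divide_right_mono)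
  qed
  have "ennreal (?m * (2 * r)) = (\<integral>\<^sup>+ y. ennreal ?m * indicator ?I y \<partial>lborel)"
    using assms m by (simp add: nn_integral_cmult_indicator ennreal_mult)
  also have "\<dots> \<le> (\<integral>\<^sup>+ y. ennreal (std_normal_density y) * indicator ?I y \<partial>lborel)"
    using le by (intro nn_integral_mono) (auto simp: indicator_def intro!: ennreal_leI)
  also have "\<dots> = emeasure std_gaussian ?I"
    by (simp add: std_gaussian_def emeasure_density)
  finally show "?m * (2 * r) \<le> prob ?I"
    by (simp add: emeasure_eq_measure)
qed

text \<open>A 1-Lipschitz function moves by at most \<open>\<epsilon>/3\<close> on an interval of
  radius \<open>\<epsilon>/3\<close> about \<open>x\<close>. The mass of such intervals has a lower
  bound \<open>c\<close> valid for all \<open>x\<close> with \<open>\<bar>x\<bar> \<le> R\<close>,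
  so one \<open>\<delta>\<close> serves them all.\<close>

lemma Lip1_close_if_gaussian_ky_fan_less:
  assumes "0 < \<epsilon>"
  shows "\<exists>\<delta>>0. \<forall>p\<in>Lip1. \<forall>q\<in>Lip1. ky_fan std_gaussian p q < \<delta> \<longrightarrow>
           (\<forall>x. \<bar>x\<bar> \<le> R \<longrightarrow> \<bar>p x - q x\<bar> \<le> \<epsilon>)"
proof -
  interpret prob_space std_gaussian by (rule prob_space_std_gaussian)
  obtain c where c: "c > 0" "\<And>x. \<bar>x\<bar> \<le> R \<Longrightarrow> c \<le> prob {x - \<epsilon>/3<..<x + \<epsilon>/3}"
    using std_gaussian_interval_ge[of "\<epsilon>/3" R] assms by auto
  have "\<bar>p x - q x\<bar> \<le> 3 * (\<epsilon>/3)"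
    if "p \<in> Lip1" "q \<in> Lip1" "ky_fan std_gaussian p q < min c (\<epsilon>/3)" "\<bar>x\<bar> \<le> R" for p q x
  proof (rule abs_diff_le_if_ky_fan_less[where f = p and g = q and x = x and \<delta> = "min c (\<epsilon>/3)" and B = "{x - \<epsilon>/3<..<x + \<epsilon>/3}"])
    show "p \<in> borel_measurable std_gaussian" "q \<in> borel_measurable std_gaussian"
      using that Lip1_borel_measurable by (auto cong: measurable_cong_sets)
    show "\<bar>p y - p x\<bar> \<le> \<epsilon>/3" "\<bar>q y - q x\<bar> \<le> \<epsilon>/3" if "y \<in> {x - \<epsilon>/3<..<x + \<epsilon>/3}" for y
    proof -
      have "\<bar>y - x\<bar> \<le> \<epsilon>/3" using that unfolding abs_le_iff greaterThanLessThan_iff by linarith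
      then show "\<bar>p y - p x\<bar> \<le> \<epsilon>/3" "\<bar>q y - q x\<bar> \<le> \<epsilon>/3"
        using Lip1_abs_le[OF \<open>p \<in> Lip1\<close>, of y x] Lip1_abs_le[OF \<open>q \<in> Lip1\<close>, of y x] by linarith+
    qed
  qed (use that c in \<open>auto simp: min_le_iff_disj\<close>)
  then show ?thesis using c assms by (intro exI[of _ "min c (\<epsilon>/3)"]) auto
qed

text \<open>Off an event of probability below \<open>\<epsilon>\<close>, \<open>g\<close> takes
  values of modulus at most \<open>R\<close>, where \<open>p\<close> and \<open>q\<close> are
  uniformly close. The \<open>\<delta>\<close> depends on \<open>g\<close> through \<open>R\<close>,
  which is why finite nets are later chosen for each \<open>g\<close> separately.\<close>

lemma (in prob_space) ky_fan_comp_le_if_gaussian_ky_fan_less: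
  assumes [measurable]: "g \<in> borel_measurable M" and "0 < \<epsilon>"
  shows "\<exists>\<delta>>0. \<forall>p\<in>Lip1. \<forall>q\<in>Lip1. ky_fan std_gaussian p q < \<delta> \<longrightarrow> ky_fan M (p \<circ> g) (q \<circ> g) \<le> \<epsilon>"
proof -
  obtain R where R: "prob {x\<in>space M. \<bar>g x\<bar> > R} < \<epsilon>"
    using ex_prob_abs_gt_less assms by blast
  obtain \<delta> where \<delta>: "\<delta> > 0" "\<And>p q x. p \<in> Lip1 \<Longrightarrow> q \<in> Lip1 \<Longrightarrow> ky_fan std_gaussian p q < \<delta> \<Longrightarrow>
      \<bar>x\<bar> \<le> R \<Longrightarrow> \<bar>p x - q x\<bar> \<le> \<epsilon>"
    using Lip1_close_if_gaussian_ky_fan_less[OF \<open>0 < \<epsilon>\<close>, of R] by blast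
  have "ky_fan M (p \<circ> g) (q \<circ> g) \<le> \<epsilon>"
    if "p \<in> Lip1" "q \<in> Lip1" "ky_fan std_gaussian p q < \<delta>" for p q
  proof (rule ky_fan_le)
    have "prob {x\<in>space M. \<bar>(p \<circ> g) x - (q \<circ> g) x\<bar> > \<epsilon>} \<le> prob {x\<in>space M. \<bar>g x\<bar> > R}"
      using \<delta>(2)[OF that] by (intro finite_measure_mono) (force simp: not_le[symmetric])+
    then show "prob {x\<in>space M. \<bar>(p \<circ> g) x - (q \<circ> g) x\<bar> > \<epsilon>} \<le> \<epsilon>" using R by simp
  qed (use \<open>0 < \<epsilon>\<close> in simp)
  then show ?thesis using \<delta>(1) by blast
qed

section \<open>Feature functions of a geometric data set\<close>

context geometric_data_set
begin

sublocale prob_space \<mu> by (rule prob)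

text \<open>For fixed \<open>x\<close> and \<open>y\<close> the inequality is a closed condition on
  two evaluations, so it passes from \<open>F\<close> to its pointwise closure.\<close>

lemma closure_abs_le:
  assumes "f \<in> closure F"
  shows "\<bar>f x - f y\<bar> \<le> data_dist F x y"
proof -
  have "closed {f :: 'a \<Rightarrow> real. \<bar>f x - f y\<bar> \<le> data_dist F x y}"
    by (intro closed_Collect_le continuous_intros continuous_on_product_coordinates)
  moreover have "F \<subseteq> {f. \<bar>f x - f y\<bar> \<le> data_dist F x y}"
    using data_dist_finite[of x y] by (auto simp: data_dist_def intro!: cSUP_upper)
  ultimately have "closure F \<subseteq> {f. \<bar>f x - f y\<bar> \<le> data_dist F x y}" by (simp add: closure_minimal)
  with assms show ?thesis by auto
qed

lemma space_eq_UNIV [simp]: "space \<mu> = UNIV"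
  using sets_eq_imp_space_eq[OF borel_sets] by simp

lemma open_sets_measurable:
  assumes "openin (Metric_space.mtopology UNIV (data_dist F)) U"
  shows "U \<in> sets \<mu>"
  unfolding borel_sets using assms by (subst sets_measure_of) auto

lemma closure_borel_measurable:
  assumes "f \<in> closure F"
  shows "f \<in> borel_measurable \<mu>"
proof (rule borel_measurableI)
  interpret D: Metric_space UNIV "data_dist F" by (rule metric)
  fix S :: "real set" assume "open S"
  have "openin D.mtopology (f -` S)"
    unfolding D.openin_mtopology
  proof (intro conjI allI impI)
    fix x assume "x \<in> f -` S"
    then obtain e where e: "e > 0" "\<And>y. \<bar>y - f x\<bar> < e \<Longrightarrow> y \<in> S"
      using \<open>open S\<close> unfolding open_dist dist_real_def by auto
    have "f y \<in> S" if "y \<in> D.mball x e" for y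
      using that closure_abs_le[OF assms, of x y] by (intro e(2)) (simp add: D.in_mball abs_minus_commute)
    then have "D.mball x e \<subseteq> f -` S" by auto
    then show "\<exists>r>0. D.mball x r \<subseteq> f -` S" using e by blast
  qed simp
  then show "f -` S \<inter> space \<mu> \<in> sets \<mu>" by (simp add: open_sets_measurable)
qed

sublocale KF: bounded_pseudometric "closure F" "ky_fan \<mu>"
  using closure_borel_measurable by (intro bounded_pseudometric_ky_fan) blast

text \<open>The counterpart of the Gaussian estimate: a ball about \<open>x\<close> has positive
  mass by full support, and functions in \<open>closure F\<close> are 1-Lipschitz for
  \<open>data_dist F\<close>. Here \<open>\<delta>\<close> depends on \<open>x\<close>, which is
  enough for pointwise convergence.\<close>

lemma closure_close_if_ky_fan_less:
  assumes "0 < \<epsilon>"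
  shows "\<exists>\<delta>>0. \<forall>f\<in>closure F. \<forall>g\<in>closure F. ky_fan \<mu> f g < \<delta> \<longrightarrow> \<bar>f x - g x\<bar> \<le> \<epsilon>"
proof -
  interpret D: Metric_space UNIV "data_dist F" by (rule metric)
  let ?B = "D.mball x (\<epsilon>/3)"
  have B: "openin D.mtopology ?B" "x \<in> ?B" using assms by auto
  then have pos: "0 < prob ?B" by (intro full_support) blast+
  have "\<bar>f x - g x\<bar> \<le> 3 * (\<epsilon>/3)"
    if "f \<in> closure F" "g \<in> closure F" "ky_fan \<mu> f g < min (\<epsilon>/3) (prob ?B)" for f g
  proof (rule abs_diff_le_if_ky_fan_less[where f = f and g = g and x = x and
        \<delta> = "min (\<epsilon>/3) (prob ?B)" and B = ?B])
    show "\<bar>f y - f x\<bar> \<le> \<epsilon>/3" "\<bar>g y - g x\<bar> \<le> \<epsilon>/3" if "y \<in> ?B" for y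
      using closure_abs_le[OF \<open>f \<in> closure F\<close>, of y x] closure_abs_le[OF \<open>g \<in> closure F\<close>, of y x] that
      by (auto simp: D.in_mball D.commute)
  qed (use that B in \<open>auto intro: closure_borel_measurable open_sets_measurable\<close>)
  then show ?thesis using pos assms by (intro exI[of _ "min (\<epsilon>/3) (prob ?B)"]) auto
qed

lemma ky_fan_eq_0_imp_eq:
  assumes "f \<in> closure F" "g \<in> closure F" "ky_fan \<mu> f g = 0"
  shows "f = g"
proof
  fix x
  have "\<bar>f x - g x\<bar> \<le> \<epsilon>" if "0 < \<epsilon>" for \<epsilon>
    using closure_close_if_ky_fan_less[OF that, of x] assms by auto
  then have "\<bar>f x - g x\<bar> \<le> 0" by (rule field_le_epsilon[where y = 0, simplified])
  then show "f x = g x" by simp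
qed

lemma closure_pointwise_limit:
  assumes "\<And>n. f n \<in> closure F" "\<And>x. (\<lambda>n. f n x) \<longlonglongrightarrow> g x"
  shows "g \<in> closure F"
proof (rule Lim_in_closed_set)
  \<comment> \<open>Coordinatewise convergence is convergence in the product topology, which is the
    topology of the function type.\<close>
  have "limitin (product_topology (\<lambda>_. euclidean) UNIV) f g sequentially"
    using assms(2) by (simp add: limitin_componentwise)
  then show "f \<longlonglongrightarrow> g" by (metis euclidean_product_topology limitin_canonical_iff)
qed (use assms in auto)

text \<open>A Ky Fan Cauchy sequence is Cauchy at every point by the local estimate. Its pointwise
  limit stays in \<open>closure F\<close>, and pointwise convergence gives Ky Fan convergence
  back.\<close>

lemma closure_pm_complete: "pm_complete (ky_fan \<mu>) (closure F)"
  unfolding pm_complete_def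
proof (intro allI impI)
  fix f :: "nat \<Rightarrow> 'a \<Rightarrow> real"
  assume "range f \<subseteq> closure F"
    and Cauchy: "\<forall>\<epsilon>>0. \<exists>N. \<forall>m\<ge>N. \<forall>n\<ge>N. ky_fan \<mu> (f m) (f n) < \<epsilon>"
  then have f: "f n \<in> closure F" for n by blast
  have "Cauchy (\<lambda>n. f n x)" for x
  proof (rule metric_CauchyI)
    fix e :: real assume "0 < e"
    then obtain \<delta> where \<delta>: "\<delta> > 0"
      "\<forall>f\<in>closure F. \<forall>g\<in>closure F. ky_fan \<mu> f g < \<delta> \<longrightarrow> \<bar>f x - g x\<bar> \<le> e/2"
      using closure_close_if_ky_fan_less[of "e/2" x] by auto
    then obtain N where "\<forall>m\<ge>N. \<forall>n\<ge>N. ky_fan \<mu> (f m) (f n) < \<delta>" using Cauchy by blast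
    then have "dist (f m x) (f n x) < e" if "m \<ge> N" "n \<ge> N" for m n
      using \<delta>(2) f that \<open>0 < e\<close> by (force simp: dist_real_def)
    then show "\<exists>N. \<forall>m\<ge>N. \<forall>n\<ge>N. dist (f m x) (f n x) < e" by blast
  qed
  then have "\<forall>x. \<exists>l. (\<lambda>n. f n x) \<longlonglongrightarrow> l"
    using Cauchy_convergent_iff convergent_def by blast
  then obtain g where g: "\<And>x. (\<lambda>n. f n x) \<longlonglongrightarrow> g x" by metis
  then have "g \<in> closure F" using f by (rule closure_pointwise_limit[rotated])
  moreover have "\<forall>\<epsilon>>0. \<exists>N. \<forall>n\<ge>N. ky_fan \<mu> (f n) g < \<epsilon>"
    using ky_fan_small_if_tendsto[of f g] g f \<open>g \<in> closure F\<close> closure_borel_measurable by blast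
  ultimately show "\<exists>l\<in>closure F. \<forall>\<epsilon>>0. \<exists>N. \<forall>n\<ge>N. ky_fan \<mu> (f n) l < \<epsilon>" by blast
qed

end

section \<open>Compactness modulo a monoidal family\<close>

lemma comp_familyI: "p \<in> L \<Longrightarrow> f \<in> C \<Longrightarrow> p \<circ> f \<in> comp_family L C"
  by (auto simp: comp_family_def)

lemma comp_fun_eq_comp_family: "comp_fun L f = comp_family L {f}"
  by (auto simp: comp_fun_def comp_family_def)

lemma family_quotient_eq_image: "family_quotient G L = comp_fun L ` G"
  by (auto simp: family_quotient_def)

text \<open>In \<open>enat\<close> the infimum of the empty set is \<open>\<infinity>\<close>, so
  finiteness amounts to the existence of one finite net.\<close>

lemma Cov_less_infinity_iff:
  "Cov G \<epsilon> L M < \<infinity> \<longleftrightarrow>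
     (\<exists>N. finite N \<and> N \<subseteq> G \<and> G \<subseteq> open_nbhd (comp_family L N) \<epsilon> (ky_fan M))"
  unfolding Cov_def Inf_less_iff by auto

lemma monoidalD:
  assumes "monoidal L"
  shows "L \<subseteq> Lip1" "id \<in> L" "\<And>p q. p \<in> L \<Longrightarrow> q \<in> L \<Longrightarrow> p \<circ> q \<in> L"
  using assms by (auto simp: monoidal_def)

lemma bounded_pseudometric_gaussian: "bounded_pseudometric Lip1 (ky_fan std_gaussian)"
proof -
  interpret prob_space std_gaussian by (rule prob_space_std_gaussian)
  show ?thesis
    using Lip1_borel_measurable by (intro bounded_pseudometric_ky_fan) (auto cong: measurable_cong_sets)
qed

text \<open>The two inclusions are kept apart from the Hausdorff distance because each is carried
  over to the data set on its own, by composing with a feature function.\<close>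

lemma self_compact_finite_net:
  assumes "monoidal L" "self_compact L" "0 < \<delta>"
  shows "\<exists>Q. finite Q \<and> Q \<subseteq> L \<and>
    (\<forall>p\<in>L. \<exists>q\<in>Q. comp_fun L p \<subseteq> open_nbhd (comp_fun L q) \<delta> (ky_fan std_gaussian) \<and>
                      comp_fun L q \<subseteq> open_nbhd (comp_fun L p) \<delta> (ky_fan std_gaussian))"
proof -
  interpret G: bounded_pseudometric Lip1 "ky_fan std_gaussian"
    by (rule bounded_pseudometric_gaussian)
  let ?H = "hausdorff_distance (ky_fan std_gaussian)"
  have "nonempty_closed_subsets Lip1 (ky_fan std_gaussian) \<subseteq> {A. A \<subseteq> Lip1 \<and> A \<noteq> {}}"
    by (auto simp: nonempty_closed_subsets_def closedin_def topspace_pm_topology)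
  then interpret H: pseudometric "nonempty_closed_subsets Lip1 (ky_fan std_gaussian)" ?H
    by (rule pseudometric.subspace[OF G.pseudometric_hausdorff_distance])
  have "pm_totally_bounded ?H (family_quotient L L)"
    using assms(2) by (intro H.compactin_imp_pm_totally_bounded) (simp add: self_compact_def)
  then obtain K where K: "finite K" "K \<subseteq> family_quotient L L"
    "\<forall>A\<in>family_quotient L L. \<exists>B\<in>K. ?H B A < \<delta>"
    using \<open>0 < \<delta>\<close> by (rule pm_totally_boundedE)
  then obtain Q where Q: "finite Q" "Q \<subseteq> L" "K = comp_fun L ` Q"
    unfolding family_quotient_eq_image by (metis finite_subset_image)
  have sub: "comp_fun L p \<subseteq> Lip1" "comp_fun L p \<noteq> {}" if "p \<in> L" for p
    using monoidalD[OF assms(1)] that by (auto simp: comp_fun_def subset_iff)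
  have "\<exists>q\<in>Q. comp_fun L p \<subseteq> open_nbhd (comp_fun L q) \<delta> (ky_fan std_gaussian) \<and>
           comp_fun L q \<subseteq> open_nbhd (comp_fun L p) \<delta> (ky_fan std_gaussian)" if p: "p \<in> L" for p
  proof -
    obtain q where q: "q \<in> Q" "?H (comp_fun L q) (comp_fun L p) < \<delta>"
      using K(3) Q(3) p by (auto simp: family_quotient_eq_image)
    then have "q \<in> L" using Q by blast
    then show ?thesis using G.hausdorff_distance_less[OF sub sub q(2)] p q(1) by blast
  qed
  then show ?thesis using Q by blast
qed

section \<open>Orbits under the monoidal family\<close>

locale monoidal_data_set = geometric_data_set +
  fixes L :: "(real \<Rightarrow> real) set"
  assumes monoidal: "monoidal L" and L_closed: "L_closed L F"
begin

abbreviation "H \<equiv> hausdorff_distance (ky_fan \<mu>)"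

sublocale H: pseudometric "{A. A \<subseteq> closure F \<and> A \<noteq> {}}" H
  by (rule KF.pseudometric_hausdorff_distance)

lemma comp_in_closure: "p \<in> L \<Longrightarrow> f \<in> closure F \<Longrightarrow> p \<circ> f \<in> closure F"
  using L_closed by (auto simp: L_closed_def comp_family_def)

lemma comp_family_subset: "C \<subseteq> closure F \<Longrightarrow> comp_family L C \<subseteq> closure F"
  using comp_in_closure by (auto simp: comp_family_def)

lemma subset_comp_family: "C \<subseteq> comp_family L C"
proof
  fix f assume "f \<in> C"
  then have "id \<circ> f \<in> comp_family L C" by (intro comp_familyI monoidalD[OF monoidal])
  then show "f \<in> comp_family L C" by simp
qed

lemma comp_fun_subset: "f \<in> closure F \<Longrightarrow> comp_fun L f \<subseteq> closure F"
  by (simp add: comp_fun_eq_comp_family comp_family_subset)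

lemma in_comp_fun: "f \<in> comp_fun L f"
  using subset_comp_family[of "{f}"] by (simp add: comp_fun_eq_comp_family)

lemma comp_in_comp_family:
  assumes "p \<in> L" "f \<in> comp_family L C"
  shows "p \<circ> f \<in> comp_family L C"
proof -
  obtain q g where "q \<in> L" "g \<in> C" "f = q \<circ> g" using assms(2) by (auto simp: comp_family_def)
  then show ?thesis
    using comp_familyI[of "p \<circ> q" L g C] monoidalD(3)[OF monoidal assms(1)] by (simp add: comp_assoc)
qed

lemma ky_fan_comp_le:
  assumes "p \<in> L" "f \<in> closure F" "g \<in> closure F"
  shows "ky_fan \<mu> (p \<circ> f) (p \<circ> g) \<le> ky_fan \<mu> f g"
proof (rule ky_fan_mono)
  show "\<bar>(p \<circ> f) x - (p \<circ> g) x\<bar> \<le> \<bar>f x - g x\<bar>" for x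
    using monoidalD(1)[OF monoidal] assms(1) by (auto intro: Lip1_abs_le)
qed (use assms closure_borel_measurable in auto)

text \<open>It suffices to approximate generators: if \<open>g\<close> is close to \<open>f\<close>,
  then \<open>p \<circ> g\<close> is at least as close to \<open>p \<circ> f\<close> and stays in
  the invariant set \<open>comp_family L B\<close>.\<close>

lemma comp_family_open_nbhd:
  assumes "A \<subseteq> closure F" "B \<subseteq> closure F" "A \<subseteq> open_nbhd (comp_family L B) \<epsilon> (ky_fan \<mu>)"
  shows "comp_family L A \<subseteq> open_nbhd (comp_family L B) \<epsilon> (ky_fan \<mu>)"
proof
  fix h assume "h \<in> comp_family L A"
  then obtain p f where h: "p \<in> L" "f \<in> A" "h = p \<circ> f" by (auto simp: comp_family_def)
  then obtain g where g: "g \<in> comp_family L B" "ky_fan \<mu> g f < \<epsilon>"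
    using assms(3) by (auto simp: open_nbhd_def)
  have "g \<in> closure F" "f \<in> closure F" using g h assms(1) comp_family_subset[OF assms(2)] by blast+
  then have "ky_fan \<mu> (p \<circ> g) h < \<epsilon>"
    using ky_fan_comp_le[OF h(1)] g(2) h(3) by fastforce
  with comp_in_comp_family[OF h(1) g(1)] show "h \<in> open_nbhd (comp_family L B) \<epsilon> (ky_fan \<mu>)"
    by (auto simp: open_nbhd_def)
qed

lemma comp_fun_open_nbhd:
  assumes "f \<in> closure F" "g \<in> closure F" "ky_fan \<mu> g f < \<epsilon>"
  shows "comp_fun L f \<subseteq> open_nbhd (comp_fun L g) \<epsilon> (ky_fan \<mu>)"
  unfolding comp_fun_eq_comp_family
  using assms subset_comp_family[of "{g}"]
  by (intro comp_family_open_nbhd) (auto simp: open_nbhd_def)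

section \<open>Finite covering numbers and total boundedness of the orbits\<close>

text \<open>Since \<open>id\<close> lies in \<open>L\<close>, each \<open>f\<close> belongs to its
  own orbit, so an orbit close to that of \<open>f\<close> contains a function close to
  \<open>f\<close>.\<close>

lemma L_compact_if_totally_bounded:
  assumes "pm_totally_bounded H (family_quotient (closure F) L)"
  shows "L_compact L F \<mu>"
  unfolding L_compact_def Cov_less_infinity_iff
proof (intro conjI L_closed allI impI)
  fix \<epsilon> :: real assume "0 < \<epsilon>"
  with assms obtain K where K: "finite K" "K \<subseteq> family_quotient (closure F) L"
    "\<forall>A\<in>family_quotient (closure F) L. \<exists>B\<in>K. H B A < \<epsilon>"
    by (rule pm_totally_boundedE)
  then obtain N where N: "finite N" "N \<subseteq> closure F" "K = comp_fun L ` N"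
    unfolding family_quotient_eq_image by (metis finite_subset_image)
  have "f \<in> open_nbhd (comp_family L N) \<epsilon> (ky_fan \<mu>)" if f: "f \<in> closure F" for f
  proof -
    obtain g where g: "g \<in> N" "H (comp_fun L g) (comp_fun L f) < \<epsilon>"
      using K(3) N(3) f by (auto simp: family_quotient_eq_image)
    have "g \<in> closure F" using g N by blast
    then have "comp_fun L f \<subseteq> open_nbhd (comp_fun L g) \<epsilon> (ky_fan \<mu>)"
      using in_comp_fun comp_fun_subset f g(2) by (intro KF.hausdorff_distance_less) auto
    moreover have "comp_fun L g \<subseteq> comp_family L N"
      using g(1) by (auto simp: comp_fun_def comp_family_def)
    ultimately show ?thesis using in_comp_fun[of f] by (auto simp: open_nbhd_def)
  qed
  with N show "\<exists>N. finite N \<and> N \<subseteq> closure F \<and> closure F \<subseteq> open_nbhd (comp_family L N) \<epsilon> (ky_fan \<mu>)"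
    by blast
qed

text \<open>An element of the orbit of \<open>p \<circ> g\<close> is
  \<open>(r \<circ> p) \<circ> g\<close>. In the Gaussian distance \<open>r \<circ> p\<close> is
  close to some \<open>s \<circ> q\<close>, and composing both with \<open>g\<close> preserves
  closeness.\<close>

lemma comp_fun_finite_net:
  assumes "self_compact L" "g \<in> closure F" "0 < \<epsilon>"
  shows "\<exists>Q. finite Q \<and> Q \<subseteq> L \<and>
    (\<forall>p\<in>L. \<exists>q\<in>Q. H (comp_fun L (q \<circ> g)) (comp_fun L (p \<circ> g)) \<le> \<epsilon>)"
proof -
  \<comment> \<open>The bound \<open>\<epsilon>/2\<close> turns a weak inequality into the strict
    one required by \<open>open_nbhd\<close>.\<close>
  obtain \<delta> where \<delta>: "\<delta> > 0" "\<And>p q. p \<in> Lip1 \<Longrightarrow> q \<in> Lip1 \<Longrightarrow> ky_fan std_gaussian p q < \<delta> \<Longrightarrow>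
      ky_fan \<mu> (p \<circ> g) (q \<circ> g) \<le> \<epsilon>/2"
    using ky_fan_comp_le_if_gaussian_ky_fan_less[OF closure_borel_measurable[OF assms(2)], of "\<epsilon>/2"]
      assms(3) by auto
  have transfer: "comp_fun L (p \<circ> g) \<subseteq> open_nbhd (comp_fun L (q \<circ> g)) \<epsilon> (ky_fan \<mu>)"
    if "p \<in> L" "q \<in> L" and sub: "comp_fun L p \<subseteq> open_nbhd (comp_fun L q) \<delta> (ky_fan std_gaussian)" for p q
  proof
    fix h assume "h \<in> comp_fun L (p \<circ> g)"
    then obtain r where r: "r \<in> L" "h = (r \<circ> p) \<circ> g" by (auto simp: comp_fun_def comp_assoc)
    then have "r \<circ> p \<in> comp_fun L p" by (auto simp: comp_fun_def)
    with sub have "r \<circ> p \<in> open_nbhd (comp_fun L q) \<delta> (ky_fan std_gaussian)" by (rule subsetD)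
    then obtain s where s: "s \<in> L" "ky_fan std_gaussian (s \<circ> q) (r \<circ> p) < \<delta>"
      by (auto simp: comp_fun_def open_nbhd_def)
    have "r \<circ> p \<in> Lip1" "s \<circ> q \<in> Lip1"
      using monoidalD(1,3)[OF monoidal] that(1,2) r(1) s(1) by (simp_all add: subsetD)
    then have "ky_fan \<mu> ((s \<circ> q) \<circ> g) h < \<epsilon>"
      using \<delta>(2)[of "s \<circ> q" "r \<circ> p"] s r assms(3) by simp
    moreover have "(s \<circ> q) \<circ> g \<in> comp_fun L (q \<circ> g)"
      using s by (auto simp: comp_fun_def comp_assoc)
    ultimately show "h \<in> open_nbhd (comp_fun L (q \<circ> g)) \<epsilon> (ky_fan \<mu>)"
      unfolding open_nbhd_def mem_Collect_eq by (rule bexI)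
  qed
  obtain Q where Q: "finite Q" "Q \<subseteq> L" "\<forall>p\<in>L. \<exists>q\<in>Q.
      comp_fun L p \<subseteq> open_nbhd (comp_fun L q) \<delta> (ky_fan std_gaussian) \<and>
      comp_fun L q \<subseteq> open_nbhd (comp_fun L p) \<delta> (ky_fan std_gaussian)"
    using self_compact_finite_net[OF monoidal assms(1) \<delta>(1)] by blast
  have "\<exists>q\<in>Q. H (comp_fun L (q \<circ> g)) (comp_fun L (p \<circ> g)) \<le> \<epsilon>" if p: "p \<in> L" for p
  proof -
    obtain q where q: "q \<in> Q"
      "comp_fun L p \<subseteq> open_nbhd (comp_fun L q) \<delta> (ky_fan std_gaussian)"
      "comp_fun L q \<subseteq> open_nbhd (comp_fun L p) \<delta> (ky_fan std_gaussian)"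
      using Q(3) p by blast
    then have "q \<in> L" using Q by blast
    then have "H (comp_fun L (q \<circ> g)) (comp_fun L (p \<circ> g)) \<le> \<epsilon>"
      using p q assms(3) by (intro KF.hausdorff_distance_le transfer)
    with q(1) show ?thesis by (intro bexI[of _ q])
  qed
  with Q(1,2) show ?thesis by (intro exI[of _ Q]) simp
qed

lemma totally_bounded_if_L_compact:
  assumes "self_compact L" "L_compact L F \<mu>"
  shows "pm_totally_bounded H (family_quotient (closure F) L)"
proof (rule H.pm_totally_boundedI)
  have mem: "comp_fun L f \<in> {A. A \<subseteq> closure F \<and> A \<noteq> {}}" if "f \<in> closure F" for f
    using that comp_fun_subset in_comp_fun[of f] by auto
  then show "family_quotient (closure F) L \<subseteq> {A. A \<subseteq> closure F \<and> A \<noteq> {}}"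
    unfolding family_quotient_eq_image by blast
  fix e :: real assume "0 < e"
  \<comment> \<open>Two weak errors of \<open>\<epsilon>\<close> arise, from \<open>f\<close> to
    \<open>p \<circ> g\<close> and from \<open>p\<close> to \<open>q\<close>; a third share makes
    the total strictly less than \<open>e\<close>.\<close>
  define \<epsilon> where "\<epsilon> = e / 3"
  have \<epsilon>: "0 < \<epsilon>" using \<open>0 < e\<close> by (simp add: \<epsilon>_def)
  obtain N where N: "finite N" "N \<subseteq> closure F"
    "closure F \<subseteq> open_nbhd (comp_family L N) \<epsilon> (ky_fan \<mu>)"
    using assms(2) \<epsilon> unfolding L_compact_def Cov_less_infinity_iff by blast
  have "\<exists>Q. \<forall>g\<in>N. finite (Q g) \<and> Q g \<subseteq> L \<and>
      (\<forall>p\<in>L. \<exists>q\<in>Q g. H (comp_fun L (q \<circ> g)) (comp_fun L (p \<circ> g)) \<le> \<epsilon>)"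
    by (rule bchoice) (use comp_fun_finite_net[OF assms(1) _ \<epsilon>] N(2) in blast)
  then obtain Q where Q: "\<forall>g\<in>N. finite (Q g) \<and> Q g \<subseteq> L \<and>
      (\<forall>p\<in>L. \<exists>q\<in>Q g. H (comp_fun L (q \<circ> g)) (comp_fun L (p \<circ> g)) \<le> \<epsilon>)"
    by (rule exE)
  let ?K = "\<Union>g\<in>N. (\<lambda>q. comp_fun L (q \<circ> g)) ` Q g"
  have K_cl: "q \<circ> g \<in> closure F" if "g \<in> N" "q \<in> Q g" for g q
    using that Q N(2) by (intro comp_in_closure) auto
  have "\<exists>A\<in>?K. H A (comp_fun L f) < e" if f: "f \<in> closure F" for f
  proof -
    obtain p g where pg: "p \<in> L" "g \<in> N" "ky_fan \<mu> (p \<circ> g) f < \<epsilon>"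
      using N(3) f by (auto simp: open_nbhd_def comp_family_def)
    obtain q where q: "q \<in> Q g" "H (comp_fun L (q \<circ> g)) (comp_fun L (p \<circ> g)) \<le> \<epsilon>"
      using Q pg(1,2) by meson
    have p_cl: "p \<circ> g \<in> closure F" using pg N by (intro comp_in_closure) auto
    have "H (comp_fun L (p \<circ> g)) (comp_fun L f) \<le> \<epsilon>"
      using pg(3) KF.commute[OF p_cl f] p_cl f \<epsilon>
      by (intro KF.hausdorff_distance_le comp_fun_open_nbhd) auto
    moreover have "H (comp_fun L (q \<circ> g)) (comp_fun L f) \<le>
        H (comp_fun L (q \<circ> g)) (comp_fun L (p \<circ> g)) + H (comp_fun L (p \<circ> g)) (comp_fun L f)"
      using K_cl[OF pg(2) q(1)] p_cl f by (intro H.triangle mem)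
    ultimately have "H (comp_fun L (q \<circ> g)) (comp_fun L f) < e"
      using q(2) \<epsilon> by (simp add: \<epsilon>_def)
    then show ?thesis using pg(2) q(1) by blast
  qed
  moreover have "finite ?K" using N(1) Q by simp
  moreover have "?K \<subseteq> {A. A \<subseteq> closure F \<and> A \<noteq> {}}" using mem K_cl by blast
  ultimately show "\<exists>K. finite K \<and> K \<subseteq> {A. A \<subseteq> closure F \<and> A \<noteq> {}} \<and>
      (\<forall>A\<in>family_quotient (closure F) L. \<exists>B\<in>K. H B A < e)"
    unfolding family_quotient_eq_image by (intro exI[of _ ?K] conjI) simp_all
qed

section \<open>Invariant sets generated by closed sets\<close>

abbreviation "invariant_family \<equiv> {comp_family L C | C. C \<in> nonempty_closed_subsets (closure F) (ky_fan \<mu>)}"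

lemma nonempty_closed_subsetsD:
  "C \<in> nonempty_closed_subsets (closure F) (ky_fan \<mu>) \<Longrightarrow> C \<subseteq> closure F \<and> C \<noteq> {}"
  by (auto simp: nonempty_closed_subsets_def closedin_def topspace_pm_topology)

lemma invariant_family_subset: "invariant_family \<subseteq> {A. A \<subseteq> closure F \<and> A \<noteq> {}}"
  using nonempty_closed_subsetsD comp_family_subset subset_comp_family by (auto; blast)

text \<open>By separation, a point \<open>g\<close> other than \<open>f\<close> has positive Ky Fan
  distance to \<open>f\<close>, and the ball of that radius about \<open>g\<close> misses
  \<open>f\<close>.\<close>

lemma singleton_nonempty_closed:
  assumes "f \<in> closure F"
  shows "{f} \<in> nonempty_closed_subsets (closure F) (ky_fan \<mu>)"
proof -
  have "\<exists>r>0. \<forall>h\<in>closure F. ky_fan \<mu> g h < r \<longrightarrow> h \<noteq> f" if g: "g \<in> closure F" "g \<noteq> f" for g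
    using ky_fan_eq_0_imp_eq[OF g(1) assms] ky_fan_nonneg[of g f] g(2)
    by (intro exI[of _ "ky_fan \<mu> g f"]) auto
  then show ?thesis
    using assms by (auto simp: nonempty_closed_subsets_def closedin_def topspace_pm_topology
        openin_pm_topology pm_open_def)
qed

lemma invariant_family_pm_complete: "pm_complete H invariant_family"
  unfolding pm_complete_def
proof (intro allI impI)
  fix \<A> :: "nat \<Rightarrow> ('a \<Rightarrow> real) set"
  assume \<A>: "range \<A> \<subseteq> invariant_family"
    and Cauchy: "\<forall>\<epsilon>>0. \<exists>N. \<forall>m\<ge>N. \<forall>n\<ge>N. H (\<A> m) (\<A> n) < \<epsilon>"
  have sub: "\<A> n \<subseteq> closure F" "\<A> n \<noteq> {}" for n
    using \<A> invariant_family_subset by blast+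
  let ?A = "KF.liminf_set \<A>"
  have A: "?A \<noteq> {}" "\<forall>\<epsilon>>0. \<exists>N. \<forall>n\<ge>N. H (\<A> n) ?A < \<epsilon>"
    using KF.hausdorff_Cauchy_liminf_set[OF closure_pm_complete sub Cauchy] .
  have "?A \<in> nonempty_closed_subsets (closure F) (ky_fan \<mu>)"
    using A(1) KF.closedin_liminf_set[OF sub(1)] by (simp add: nonempty_closed_subsets_def)
  moreover have "comp_family L ?A = ?A"
  proof (intro equalityI subset_comp_family subsetI)
    fix h assume "h \<in> comp_family L ?A"
    then obtain p f where h: "p \<in> L" "f \<in> ?A" "h = p \<circ> f" by (auto simp: comp_family_def)
    have f: "f \<in> closure F" using h by (simp add: KF.liminf_set_def)
    \<comment> \<open>Invariance of \<open>\<A> n\<close> enters here: \<open>p\<close> sends a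
      point of \<open>\<A> n\<close> near \<open>f\<close> to a point of \<open>\<A> n\<close> near
      \<open>h\<close>, with the same \<open>n\<close> and \<open>\<epsilon>\<close>, so the
      threshold for \<open>f\<close> also works for \<open>h\<close>.\<close>
    have "h \<in> open_nbhd (\<A> n) \<epsilon> (ky_fan \<mu>)" if n: "f \<in> open_nbhd (\<A> n) \<epsilon> (ky_fan \<mu>)" for n \<epsilon>
    proof -
      obtain a where a: "a \<in> \<A> n" "ky_fan \<mu> a f < \<epsilon>" using n by (auto simp: open_nbhd_def)
      have "\<A> n \<in> invariant_family" using \<A> by blast
      then obtain C where "\<A> n = comp_family L C" by blast
      then have "p \<circ> a \<in> \<A> n" using comp_in_comp_family[OF h(1)] a(1) by simp
      moreover have "ky_fan \<mu> (p \<circ> a) h < \<epsilon>"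
        using ky_fan_comp_le[OF h(1) _ f, of a] a sub(1)[of n] h(3) by auto
      ultimately show ?thesis by (auto simp: open_nbhd_def)
    qed
    then have "\<exists>N. \<forall>n\<ge>N. h \<in> open_nbhd (\<A> n) \<epsilon> (ky_fan \<mu>)" if "0 < \<epsilon>" for \<epsilon>
      using h(2) that unfolding KF.liminf_set_def by blast
    moreover have "h \<in> closure F" using h(1,3) f comp_in_closure by simp
    ultimately show "h \<in> ?A" by (simp add: KF.liminf_set_def)
  qed
  ultimately have "?A \<in> invariant_family" by (metis (mono_tags, lifting) mem_Collect_eq)
  with A(2) show "\<exists>A\<in>invariant_family. \<forall>\<epsilon>>0. \<exists>N. \<forall>n\<ge>N. H (\<A> n) A < \<epsilon>" by blast
qed

text \<open>The finite net consists of the sets generated by nonempty subsets of \<open>N\<close>,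
  where the orbits of \<open>N\<close> form a net for all orbits. To approximate
  \<open>comp_family L C\<close>, take the members of \<open>N\<close> whose orbits are close to the
  orbit of a point of \<open>C\<close>; comparing generators is enough.\<close>

lemma invariant_family_totally_bounded:
  assumes "pm_totally_bounded H (family_quotient (closure F) L)"
  shows "pm_totally_bounded H invariant_family"
proof (rule H.pm_totally_boundedI[OF invariant_family_subset])
  fix e :: real assume "0 < e"
  define \<epsilon> where "\<epsilon> = e / 2"
  have \<epsilon>: "0 < \<epsilon>" using \<open>0 < e\<close> by (simp add: \<epsilon>_def)
  obtain K where K: "finite K" "K \<subseteq> family_quotient (closure F) L"
    "\<forall>A\<in>family_quotient (closure F) L. \<exists>B\<in>K. H B A < \<epsilon>"
    using assms \<epsilon> by (rule pm_totally_boundedE)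
  then obtain N where N: "finite N" "N \<subseteq> closure F" "K = comp_fun L ` N"
    unfolding family_quotient_eq_image by (metis finite_subset_image)
  let ?K = "comp_family L ` (Pow N - {{}})"
  have net: "\<exists>A\<in>?K. H A (comp_family L C) < e"
    if "C \<in> nonempty_closed_subsets (closure F) (ky_fan \<mu>)" for C
  proof -
    have C: "C \<subseteq> closure F" "C \<noteq> {}" using nonempty_closed_subsetsD[OF that] by auto
    \<comment> \<open>Requiring a partner in \<open>C\<close> keeps the set generated by
      \<open>N'\<close> near \<open>C\<close>; the net property makes \<open>N'\<close> large enough
      for the reverse inclusion.\<close>
    define N' where "N' = {f\<in>N. \<exists>g\<in>C. H (comp_fun L f) (comp_fun L g) < \<epsilon>}"
    have approx: "\<exists>f\<in>N'. H (comp_fun L f) (comp_fun L g) < \<epsilon>" if g: "g \<in> C" for g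
    proof -
      have "comp_fun L g \<in> family_quotient (closure F) L"
        using g C by (auto simp: family_quotient_eq_image)
      then obtain f where "f \<in> N" "H (comp_fun L f) (comp_fun L g) < \<epsilon>" using K(3) N(3) by blast
      then show ?thesis using g by (auto simp: N'_def)
    qed
    have N': "N' \<subseteq> closure F" "N' \<noteq> {}" using N(2) approx C(2) by (auto simp: N'_def)
    \<comment> \<open>Each function lies in its own orbit, so closeness of the two orbits places
      either function near the orbit of the other.\<close>
    have near: "f \<in> open_nbhd (comp_fun L g) \<epsilon> (ky_fan \<mu>) \<and> g \<in> open_nbhd (comp_fun L f) \<epsilon> (ky_fan \<mu>)"
      if "f \<in> N'" "g \<in> C" "H (comp_fun L f) (comp_fun L g) < \<epsilon>" for f g
    proof -
      have fg: "f \<in> closure F" "g \<in> closure F" using that N' C by auto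
      have ne: "comp_fun L f \<noteq> {}" "comp_fun L g \<noteq> {}" using in_comp_fun by blast+
      show ?thesis
        using KF.hausdorff_distance_less[OF comp_fun_subset[OF fg(1)] ne(1)
            comp_fun_subset[OF fg(2)] ne(2) that(3)] in_comp_fun by blast
    qed
    have mono: "open_nbhd (comp_fun L f) \<epsilon> (ky_fan \<mu>) \<subseteq> open_nbhd (comp_family L B) \<epsilon> (ky_fan \<mu>)"
      if "f \<in> B" for f B
      using that by (auto simp: open_nbhd_def comp_fun_def comp_family_def)
    have "N' \<subseteq> open_nbhd (comp_family L C) \<epsilon> (ky_fan \<mu>)"
    proof
      fix f assume "f \<in> N'"
      then obtain g where "g \<in> C" "H (comp_fun L f) (comp_fun L g) < \<epsilon>" by (auto simp: N'_def)
      then show "f \<in> open_nbhd (comp_family L C) \<epsilon> (ky_fan \<mu>)"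
        using near[OF \<open>f \<in> N'\<close>] mono[of g C] by blast
    qed
    moreover have "C \<subseteq> open_nbhd (comp_family L N') \<epsilon> (ky_fan \<mu>)"
    proof
      fix g assume "g \<in> C"
      then obtain f where "f \<in> N'" "H (comp_fun L f) (comp_fun L g) < \<epsilon>" using approx by blast
      then show "g \<in> open_nbhd (comp_family L N') \<epsilon> (ky_fan \<mu>)"
        using near[OF _ \<open>g \<in> C\<close>] mono[of f N'] by blast
    qed
    ultimately have "H (comp_family L N') (comp_family L C) \<le> \<epsilon>"
      using \<epsilon> N'(1) C(1) by (intro KF.hausdorff_distance_le comp_family_open_nbhd)
    then have "H (comp_family L N') (comp_family L C) < e" using \<epsilon> by (simp add: \<epsilon>_def)
    moreover have "comp_family L N' \<in> ?K" using N'(2) by (auto simp: N'_def)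
    ultimately show ?thesis by blast
  qed
  have "?K \<subseteq> {A. A \<subseteq> closure F \<and> A \<noteq> {}}"
  proof
    fix A assume "A \<in> ?K"
    then obtain B where B: "B \<subseteq> N" "B \<noteq> {}" "A = comp_family L B" by blast
    then have "A \<subseteq> closure F" using N(2) by (simp add: comp_family_subset)
    moreover have "A \<noteq> {}" using B subset_comp_family[of B] by blast
    ultimately show "A \<in> {A. A \<subseteq> closure F \<and> A \<noteq> {}}" by blast
  qed
  moreover have "finite ?K" using N(1) by simp
  ultimately show "\<exists>K. finite K \<and> K \<subseteq> {A. A \<subseteq> closure F \<and> A \<noteq> {}} \<and>
      (\<forall>A\<in>invariant_family. \<exists>B\<in>K. H B A < e)"
    using net by (intro exI[of _ ?K]) auto
qed

lemma family_quotient_subset_invariant_family: "family_quotient (closure F) L \<subseteq> invariant_family"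
  unfolding family_quotient_eq_image comp_fun_eq_comp_family using singleton_nonempty_closed by blast

text \<open>The invariant family is always complete, so its compactness comes down to total
  boundedness, and that is equivalent to total boundedness of the orbits it contains.\<close>

lemma totally_bounded_iff_compactin:
  "pm_totally_bounded H (family_quotient (closure F) L) \<longleftrightarrow>
     compactin (pm_topology {A. A \<subseteq> closure F \<and> A \<noteq> {}} H) invariant_family"
proof
  assume "pm_totally_bounded H (family_quotient (closure F) L)"
  then show "compactin (pm_topology {A. A \<subseteq> closure F \<and> A \<noteq> {}} H) invariant_family"
    using invariant_family_subset invariant_family_pm_complete invariant_family_totally_bounded
    by (intro H.compactin_if_complete_totally_bounded)
next
  assume "compactin (pm_topology {A. A \<subseteq> closure F \<and> A \<noteq> {}} H) invariant_family"
  then show "pm_totally_bounded H (family_quotient (closure F) L)"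
    using H.compactin_imp_pm_totally_bounded H.pm_totally_bounded_subset invariant_family_subset
      family_quotient_subset_invariant_family by meson
qed

end

theorem proposition3p17:
  fixes L :: "(real \<Rightarrow> real) set"
    and F :: "('a \<Rightarrow> real) set"
    and \<mu> :: "'a measure"
  assumes "monoidal L"
    and "self_compact L"
    and "geometric_data_set F \<mu>"
    and "L_closed L F"
  shows "(L_compact L F \<mu> \<longleftrightarrow>
            pm_totally_bounded (hausdorff_distance (ky_fan \<mu>)) (family_quotient (closure F) L))
       \<and> (pm_totally_bounded (hausdorff_distance (ky_fan \<mu>)) (family_quotient (closure F) L) \<longleftrightarrow>
            compactin
              (pm_topology {A. A \<subseteq> closure F \<and> A \<noteq> {}} (hausdorff_distance (ky_fan \<mu>)))
              {comp_family L C | C. C \<in> nonempty_closed_subsets (closure F) (ky_fan \<mu>)})"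
proof -
  interpret monoidal_data_set F \<mu> L
    using assms by (simp add: monoidal_data_set_def monoidal_data_set_axioms_def)
  show ?thesis
    using totally_bounded_if_L_compact[OF assms(2)] L_compact_if_totally_bounded
      totally_bounded_iff_compactin by blast
qed

end
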